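(* Let $X=(\mathbb{R}^n,\|\cdot\|)$, where $\|\cdot\|$ is a norm on $\mathbb{R}^n$ such that $B_2^n$ is the ellipsoid of maximal volume contained in $B_X$. For any $\varepsilon\in(0,1)$ there exist contact points $x_1,\dots,x_k$ of $B_X$ with $B_2^n$ such that $$k\geq(1-\varepsilon)^2n$$ and for all real $(a_j)_{j\leq k}$, $$\frac{\varepsilon}{2-\varepsilon}\Big(\sum_{j\leq k}a_j^2\Big)^{1/2}\leq\Big\|\sum_{j\leq k}a_jx_j\Big\|_2\leq\frac{2-\varepsilon}{\varepsilon}\Big(\sum_{j\leq k}a_j^2\Big)^{1/2}.$$
   Context: $B_X$ is the unit ball of $X$, and $B_2^n$ is the unit ball of the Euclidean norm $\|\cdot\|_2$ on $\mathbb{R}^n$. A contact point of $B_X$ with $B_2^n$ is a common point of their boundaries, i.e. $x\in\mathbb{R}^n$ with $\|x\|=\|x\|_2=1$. *)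

theory Defs
  imports "HOL-Analysis.Analysis"
begin

text \<open>An arbitrary norm on \<open>\<real>\<^sup>n\<close> is a function satisfying the norm axioms; the type-class constant
  \<open>norm\<close> on \<^typ>\<open>real ^ 'n\<close> is the Euclidean norm. Nonnegativity follows from the three axioms.\<close>

definition is_norm :: "('a::real_vector \<Rightarrow> real) \<Rightarrow> bool" where
  "is_norm N \<longleftrightarrow>
     (\<forall>x. N x = 0 \<longleftrightarrow> x = 0) \<and>
     (\<forall>x y. N (x + y) \<le> N x + N y) \<and>
     (\<forall>c x. N (c *\<^sub>R x) = \<bar>c\<bar> * N x)"

definition unit_ball :: "('a \<Rightarrow> real) \<Rightarrow> 'a set" where
  "unit_ball N = {x. N x \<le> 1}"

text \<open>Ellipsoids are the nondegenerate affine images of the closed Euclidean unit ball; the centre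
  is arbitrary.\<close>

definition ellipsoid :: "(real ^ 'n) set \<Rightarrow> bool" where
  "ellipsoid E \<longleftrightarrow> (\<exists>c (T :: real ^ 'n \<Rightarrow> real ^ 'n). linear T \<and> bij T \<and> E = (\<lambda>x. c + T x) ` cball 0 1)"

definition max_volume_ellipsoid :: "(real ^ 'n) set \<Rightarrow> (real ^ 'n) set \<Rightarrow> bool" where
  "max_volume_ellipsoid E K \<longleftrightarrow>
     ellipsoid E \<and> E \<subseteq> K \<and>
     (\<forall>F. ellipsoid F \<and> F \<subseteq> K \<longrightarrow> measure lebesgue F \<le> measure lebesgue E)"

definition contact_point :: "(real ^ 'n \<Rightarrow> real) \<Rightarrow> real ^ 'n \<Rightarrow> bool" where
  "contact_point N x \<longleftrightarrow> N x = 1 \<and> norm x = 1"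

end

theory Submission
  imports Defs
begin

text \<open>
  Two facts carry the proof.

  First, maximality of the ball gives a dual form of John's theorem
  (\<open>contact_point_with_nonneg_form\<close>): every symmetric matrix \<open>M\<close> of positive trace satisfies
  \<open>x \<bullet> M x \<ge> 0\<close> at some contact point \<open>x\<close>.  Otherwise the ellipsoids \<open>(I + t M) B\<close>, which for small
  \<open>t > 0\<close> are larger than the ball \<open>B\<close>, would fit into the unit ball of the norm.  This is the
  assertion that \<open>I / n\<close> cannot be separated from the matrices \<open>x x\<^sup>T\<close>; it lets one argue as if
  there were a probability measure on contact points with mean \<open>x x\<^sup>T = I / n\<close>.

  Second, vectors are selected greedily by the two-barrier argument of Batson, Spielman and
  Srivastava.  With \<open>A\<close> the sum of the \<open>y\<^sub>j y\<^sub>j\<^sup>T\<close> chosen so far, all eigenvalues of \<open>A\<close> lie below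
  \<open>u\<close>, all nonzero ones lie above \<open>b\<close>, and the potentials \<open>tr (u - A)\<inverse>\<close> (kept small) and
  \<open>tr (b - A)\<inverse>\<close> (kept large) measure the distance of the spectrum from the barriers.  A multiple
  \<open>v\<close> of a contact point can be added, while \<open>b\<close> decreases and \<open>u\<close> increases by fixed amounts, as
  soon as two quadratic forms in \<open>v\<close> are on the right sides of 1.  The average of their
  difference over the imaginary measure is positive, hence so is the trace of the corresponding
  matrix, and the first fact supplies the contact point (\<open>vector_moving_barriers\<close>).

  The last vector costs no barrier move (\<open>vector_between_barriers\<close>), so \<open>k\<close> vectors need only
  \<open>k - 1 < (1 - \<epsilon>)\<^sup>2 n\<close> moves; this is what makes the bound \<open>k \<ge> (1 - \<epsilon>)\<^sup>2 n\<close> available without a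
  loss from rounding.  The resulting Gram matrix of the multiples \<open>y\<^sub>j = s\<^sub>j x\<^sub>j\<close> has spectrum in
  \<open>[b, u]\<close> with \<open>u / b \<le> ((2 - \<epsilon>) / \<epsilon>)\<^sup>2\<close>.  Its diagonal entries are the \<open>s\<^sub>j\<^sup>2\<close>, which therefore lie
  in \<open>[b, u]\<close> as well, and rescaling by them leaves the Gram matrix of the \<open>x\<^sub>j\<close> with spectrum in
  \<open>[b / u, u / b]\<close>.
\<close>

(* The default rewriting to x v* Q would hide the products of Q with its transpose. *)
declare transpose_matrix_vector [simp del]

section \<open>Orthogonal diagonalisation of symmetric matrices\<close>

lemma symmetric_inner_commute:
  fixes A :: "real^'n^'n"
  assumes "transpose A = A"
  shows "x \<bullet> (A *v y) = y \<bullet> (A *v x)"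
  by (metis assms dot_lmul_matrix inner_commute transpose_matrix_vector)

text \<open>A maximiser \<open>x\<close> of the form \<open>x \<bullet> A x\<close> on the unit sphere of \<open>S\<close> is an eigenvector: with \<open>\<mu>\<close> the
  maximum, \<open>g y = \<mu> (y \<bullet> y) - y \<bullet> A y\<close> is nonnegative on \<open>S\<close> and vanishes at \<open>x\<close>, so its derivative at
  \<open>x\<close> in the direction \<open>w = \<mu> x - A x\<close>, which is \<open>2 (w \<bullet> w)\<close>, is zero.\<close>

lemma eigenvector_in_invariant_subspace:
  fixes A :: "real^'n^'n"
  assumes sym: "transpose A = A" and S: "subspace S" and nz: "\<exists>x\<in>S. x \<noteq> 0"
    and inv: "\<And>x. x \<in> S \<Longrightarrow> A *v x \<in> S"
  shows "\<exists>x \<mu>. x \<in> S \<and> norm x = 1 \<and> A *v x = \<mu> *\<^sub>R x"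
proof -
  have "compact (S \<inter> sphere 0 1)"
    using closed_subspace[OF S] by (simp add: closed_Int_compact)
  moreover have "S \<inter> sphere 0 1 \<noteq> {}"
  proof -
    from nz obtain x where x: "x \<in> S" "x \<noteq> 0" by blast
    then have "(1 / norm x) *\<^sub>R x \<in> S \<inter> sphere 0 1"
      by (simp add: subspace_scale[OF S])
    then show ?thesis by blast
  qed
  moreover have "continuous_on (S \<inter> sphere 0 1) (\<lambda>x. x \<bullet> (A *v x))"
    by (intro continuous_intros linear_continuous_on matrix_vector_mul_bounded_linear)
  ultimately obtain x where x: "x \<in> S" "norm x = 1"
    and max: "\<And>y. y \<in> S \<Longrightarrow> norm y = 1 \<Longrightarrow> y \<bullet> (A *v y) \<le> x \<bullet> (A *v x)"
    using continuous_attains_sup[of "S \<inter> sphere 0 1" "\<lambda>x. x \<bullet> (A *v x)"]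
    by (metis Int_iff mem_sphere_0)
  define \<mu> where "\<mu> = x \<bullet> (A *v x)"
  define g where "g y = \<mu> * (y \<bullet> y) - y \<bullet> (A *v y)" for y
  have g_nonneg: "0 \<le> g y" if "y \<in> S" for y
  proof (cases "y = 0")
    case False
    define z where "z = (1 / norm y) *\<^sub>R y"
    have z: "z \<in> S" "norm z = 1" "y = norm y *\<^sub>R z"
      using False that by (auto simp: z_def subspace_scale[OF S])
    have "y \<bullet> (A *v y) = (norm y)\<^sup>2 * (z \<bullet> (A *v z))"
      by (subst (1 2) z(3)) (simp add: matrix_vector_mult_scaleR power2_eq_square)
    also have "\<dots> \<le> (norm y)\<^sup>2 * \<mu>"
      unfolding \<mu>_def by (intro mult_left_mono max z) auto
    finally show ?thesis by (simp add: g_def power2_norm_eq_inner mult.commute)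
  qed (simp add: g_def)
  define w where "w = \<mu> *\<^sub>R x - A *v x"
  have wS: "w \<in> S"
    unfolding w_def using x by (intro subspace_diff S subspace_scale inv)
  have expand: "g (x + t *\<^sub>R w) = 2 * t * (w \<bullet> w) + t\<^sup>2 * g w" for t
  proof -
    have xx: "x \<bullet> x = 1" using x(2) by (simp add: norm_eq_1)
    have xw: "x \<bullet> (A *v w) = w \<bullet> (A *v x)" by (rule symmetric_inner_commute[OF sym])
    have wx: "w \<bullet> (A *v x) = \<mu> * (w \<bullet> x) - w \<bullet> w"
      by (subst (3) w_def) (simp add: inner_diff_right)
    have "g (x + t *\<^sub>R w) = \<mu> * (1 + 2 * t * (w \<bullet> x) + t\<^sup>2 * (w \<bullet> w))
        - (\<mu> + 2 * t * (w \<bullet> (A *v x)) + t\<^sup>2 * (w \<bullet> (A *v w)))"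
      unfolding g_def
      by (simp add: matrix_vector_right_distrib matrix_vector_mult_scaleR inner_add_left inner_add_right
          algebra_simps power2_eq_square xx xw \<mu>_def[symmetric] inner_commute[of x w])
    then show ?thesis by (simp add: wx g_def algebra_simps)
  qed
  have "w \<bullet> w = 0"
  proof (rule ccontr)
    assume "w \<bullet> w \<noteq> 0"
    then have c: "0 < w \<bullet> w" by simp
    define G where "G = g w + 1"
    have G: "0 < G" using g_nonneg[OF wS] by (simp add: G_def)
    \<comment> \<open>near the minimiser of the quadratic \<open>t \<mapsto> g (x + t w)\<close>; \<open>G\<close> exceeds \<open>g w\<close> so as not to vanish\<close>
    define t where "t = - (w \<bullet> w) / G"
    have gw: "g w = G - 1" by (simp add: G_def)
    have "0 \<le> g (x + t *\<^sub>R w)"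
      by (intro g_nonneg subspace_add S subspace_scale x wS)
    also have "\<dots> = - (((w \<bullet> w) / G)\<^sup>2 * (G + 1))"
      unfolding expand gw t_def using G by (simp add: field_simps power2_eq_square)
    also have "\<dots> < 0" using c G by simp
    finally show False by simp
  qed
  then show ?thesis using x by (intro exI[of _ x] exI[of _ \<mu>]) (simp add: w_def)
qed

text \<open>Eigenvectors are added one at a time: the orthogonal complement of those already found is
  invariant because \<open>A\<close> is symmetric, and it is nontrivial as long as \<open>m < n\<close>.\<close>

lemma orthonormal_eigenvectors:
  fixes A :: "real^'n^'n"
  assumes sym: "transpose A = A" and "m \<le> CARD('n)"
  shows "\<exists>B. finite B \<and> card B = m \<and> pairwise orthogonal B \<and>
           (\<forall>x\<in>B. norm x = 1 \<and> (\<exists>\<mu>. A *v x = \<mu> *\<^sub>R x))"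
  using \<open>m \<le> CARD('n)\<close>
proof (induction m)
  case 0
  show ?case by (intro exI[of _ "{}"]) simp
next
  case (Suc m)
  then obtain B where B: "finite B" "card B = m" "pairwise orthogonal B"
    "\<And>x. x \<in> B \<Longrightarrow> norm x = 1" "\<And>x. x \<in> B \<Longrightarrow> \<exists>\<mu>. A *v x = \<mu> *\<^sub>R x"
    by fastforce
  define S where "S = {y. \<forall>x\<in>B. orthogonal x y}"
  have "dim B \<le> m" using dim_le_card'[OF B(1)] B(2) by simp
  then have "dim B < DIM(real^'n)" using Suc.prems by simp
  then obtain z where z: "z \<noteq> 0" "\<And>y. y \<in> span B \<Longrightarrow> orthogonal z y"
    using orthogonal_to_subspace_exists[of B] by metis
  then have "z \<in> S" by (simp add: S_def orthogonal_commute span_base)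
  moreover have "A *v y \<in> S" if "y \<in> S" for y
  proof -
    have "x \<bullet> (A *v y) = 0" if "x \<in> B" for x
    proof -
      obtain \<mu> where "A *v x = \<mu> *\<^sub>R x" using B(5)[OF \<open>x \<in> B\<close>] by blast
      then have "x \<bullet> (A *v y) = \<mu> * (y \<bullet> x)"
        by (simp add: symmetric_inner_commute[OF sym, of x])
      then show ?thesis using \<open>y \<in> S\<close> that by (simp add: S_def orthogonal_def inner_commute)
    qed
    then show ?thesis by (simp add: S_def orthogonal_def)
  qed
  moreover have "subspace S" unfolding S_def by (rule subspace_orthogonal_to_vectors)
  ultimately obtain x \<mu> where x: "x \<in> S" "norm x = 1" "A *v x = \<mu> *\<^sub>R x"
    using eigenvector_in_invariant_subspace[OF sym, of S] z(1) by blast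
  have "x \<notin> B" using x by (auto simp: S_def orthogonal_def)
  moreover have "pairwise orthogonal (insert x B)"
    using B(3) x(1) by (auto simp: pairwise_insert S_def orthogonal_commute)
  ultimately show ?case
    using B x by (intro exI[of _ "insert x B"]) auto
qed

text \<open>The function calculus of a symmetric matrix: for fixed orthogonal \<open>Q\<close> these matrices form an
  algebra isomorphic to the functions \<open>d\<close>, so that polynomials and resolvents of a
  diagonalised matrix are computed on its eigenvalues.\<close>

definition spectral_matrix :: "real^'n^'n \<Rightarrow> ('n \<Rightarrow> real) \<Rightarrow> real^'n^'n" where
  "spectral_matrix Q d = Q ** (\<chi> i j. if i = j then d i else 0) ** transpose Q"

lemma matrix_mult_diagonal_nth:
  fixes Q :: "real^'n^'n"
  shows "(Q ** (\<chi> i j. if i = j then d i else 0)) $ i $ l = Q $ i $ l * d l"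
proof -
  have "(\<Sum>k\<in>UNIV. Q $ i $ k * (if k = l then d k else 0)) = (\<Sum>k\<in>UNIV. if k = l then Q $ i $ k * d k else 0)"
    by (intro sum.cong) auto
  then show ?thesis by (simp add: matrix_matrix_mult_def)
qed

lemma diagonal_matrix_vector_nth:
  fixes x :: "real^'n"
  shows "((\<chi> i j. if i = j then d i else 0) *v x) $ l = d l * x $ l"
proof -
  have "(\<Sum>j\<in>UNIV. (if l = j then d l else 0) * x $ j) = (\<Sum>j\<in>UNIV. if l = j then d l * x $ j else 0)"
    by (intro sum.cong) auto
  then show ?thesis by (simp add: matrix_vector_mult_def)
qed

theorem spectral_theorem:
  fixes A :: "real^'n^'n"
  assumes "transpose A = A"
  obtains Q d where "orthogonal_matrix Q" "A = spectral_matrix Q d"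
proof -
  obtain B where B: "finite B" "card B = CARD('n)" "pairwise orthogonal B"
    "\<And>x. x \<in> B \<Longrightarrow> norm x = 1" "\<And>x. x \<in> B \<Longrightarrow> \<exists>\<mu>. A *v x = \<mu> *\<^sub>R x"
    using orthonormal_eigenvectors[OF assms, of "CARD('n)"] by (metis order_refl)
  obtain e where e: "bij_betw e (UNIV::'n set) B"
    using finite_same_card_bij[of "UNIV::'n set" B] B(1,2) by auto
  have eB: "e l \<in> B" for l using e by (auto simp: bij_betw_def)
  have "\<forall>l. \<exists>\<mu>. A *v e l = \<mu> *\<^sub>R e l" using B(5) eB by blast
  from choice[OF this] obtain d where d: "\<And>l. A *v e l = d l *\<^sub>R e l" by blast
  define Q :: "real^'n^'n" where "Q = (\<chi> i l. e l $ i)"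
  have colQ: "column l Q = e l" for l by (simp add: Q_def column_def vec_eq_iff)
  have "orthogonal (e i) (e j)" if "i \<noteq> j" for i j
    using B(3) eB that e by (metis bij_betw_def injD pairwiseD)
  then have Q: "orthogonal_matrix Q"
    by (simp add: orthogonal_matrix_orthonormal_columns colQ B(4) eB)
  have "A ** Q = Q ** (\<chi> i j. if i = j then d i else 0)"
  proof (rule vec_eq_iff[THEN iffD2], rule allI, rule vec_eq_iff[THEN iffD2], rule allI)
    fix i l
    have "(A ** Q) $ i $ l = (A *v e l) $ i"
      by (simp add: matrix_matrix_mult_def matrix_vector_mult_def Q_def)
    also have "\<dots> = (Q ** (\<chi> i j. if i = j then d i else 0)) $ i $ l"
      by (simp add: d matrix_mult_diagonal_nth) (simp add: Q_def)
    finally show "(A ** Q) $ i $ l = (Q ** (\<chi> i j. if i = j then d i else 0)) $ i $ l" .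
  qed
  then have "A = spectral_matrix Q d"
    using Q unfolding spectral_matrix_def orthogonal_matrix_def
    by (metis matrix_mul_assoc matrix_mul_rid)
  with Q show ?thesis by (rule that)
qed

lemma spectral_matrix_mult:
  fixes Q :: "real^'n^'n"
  assumes "orthogonal_matrix Q"
  shows "spectral_matrix Q d ** spectral_matrix Q e = spectral_matrix Q (\<lambda>l. d l * e l)"
proof -
  let ?D = "\<lambda>d. (\<chi> i j. if i = j then d i else 0) :: real^'n^'n"
  have D: "?D d ** ?D e = ?D (\<lambda>l. d l * e l)"
    by (simp add: vec_eq_iff matrix_mult_diagonal_nth)
  have "spectral_matrix Q d ** spectral_matrix Q e
      = Q ** ?D d ** (transpose Q ** Q) ** ?D e ** transpose Q"
    by (simp add: spectral_matrix_def matrix_mul_assoc)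
  also have "\<dots> = Q ** (?D d ** ?D e) ** transpose Q"
    using assms by (simp add: orthogonal_matrix matrix_mul_assoc)
  finally show ?thesis unfolding D by (simp add: spectral_matrix_def)
qed

lemma spectral_matrix_const:
  fixes Q :: "real^'n^'n"
  assumes "orthogonal_matrix Q"
  shows "spectral_matrix Q (\<lambda>_. c) = mat c"
proof -
  have "(\<chi> i j. if i = j then c else 0) = c *\<^sub>R (mat 1 :: real^'n^'n)"
    by (simp add: vec_eq_iff mat_def)
  then have "spectral_matrix Q (\<lambda>_. c) = c *\<^sub>R (Q ** transpose Q)"
    by (simp add: spectral_matrix_def scalar_matrix_assoc matrix_scalar_ac)
  then show ?thesis using assms by (simp add: orthogonal_matrix_def vec_eq_iff mat_def)
qed

lemma spectral_matrix_nth: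
  "spectral_matrix Q d $ i $ j = (\<Sum>l\<in>UNIV. d l * (Q $ i $ l * Q $ j $ l))"
proof -
  have "spectral_matrix Q d $ i $ j = (\<Sum>l\<in>UNIV. (Q ** (\<chi> i j. if i = j then d i else 0)) $ i $ l * transpose Q $ l $ j)"
    unfolding spectral_matrix_def by (subst matrix_matrix_mult_def) simp
  then show ?thesis by (simp add: matrix_mult_diagonal_nth transpose_def mult_ac)
qed

lemma spectral_matrix_diff:
  "spectral_matrix Q d - spectral_matrix Q e = spectral_matrix Q (\<lambda>l. d l - e l)"
  by (simp add: vec_eq_iff spectral_matrix_nth left_diff_distrib sum_subtractf)

lemma spectral_matrix_add:
  "spectral_matrix Q d + spectral_matrix Q e = spectral_matrix Q (\<lambda>l. d l + e l)"
  by (simp add: vec_eq_iff spectral_matrix_nth distrib_right sum.distrib)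

lemma spectral_matrix_scaleR:
  "c *\<^sub>R spectral_matrix Q d = spectral_matrix Q (\<lambda>l. c * d l)"
  by (simp add: vec_eq_iff spectral_matrix_nth sum_distrib_left mult.assoc)

lemma transpose_spectral_matrix: "transpose (spectral_matrix Q d) = spectral_matrix Q d"
  by (simp add: vec_eq_iff transpose_def spectral_matrix_nth mult.commute mult.left_commute)

lemma trace_spectral_matrix:
  fixes Q :: "real^'n^'n"
  assumes "orthogonal_matrix Q"
  shows "trace (spectral_matrix Q d) = (\<Sum>l\<in>UNIV. d l)"
proof -
  have "trace (spectral_matrix Q d) = trace (transpose Q ** (Q ** (\<chi> i j. if i = j then d i else 0)))"
    unfolding spectral_matrix_def by (rule trace_mul_sym)
  also have "\<dots> = trace ((\<chi> i j. if i = j then d i else 0) :: real^'n^'n)"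
    using assms by (simp add: orthogonal_matrix matrix_mul_assoc)
  finally show ?thesis by (simp add: trace_def)
qed

lemma det_spectral_matrix:
  fixes Q :: "real^'n^'n"
  assumes "orthogonal_matrix Q"
  shows "det (spectral_matrix Q d) = (\<Prod>l\<in>UNIV. d l)"
proof -
  have "det Q * det (transpose Q) = 1"
    using assms by (metis det_I det_mul orthogonal_matrix_def)
  moreover have "det ((\<chi> i j. if i = j then d i else 0) :: real^'n^'n) = (\<Prod>l\<in>UNIV. d l)"
    by (subst det_diagonal) auto
  ultimately show ?thesis by (simp add: spectral_matrix_def det_mul algebra_simps)
qed

lemma inner_spectral_matrix:
  fixes Q :: "real^'n^'n"
  shows "x \<bullet> (spectral_matrix Q d *v x) = (\<Sum>l\<in>UNIV. d l * ((transpose Q *v x) $ l)\<^sup>2)"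
proof -
  have "x \<bullet> (spectral_matrix Q d *v x)
      = (transpose Q *v x) \<bullet> ((\<chi> i j. if i = j then d i else 0) *v (transpose Q *v x))"
    by (simp add: spectral_matrix_def matrix_vector_mul_assoc[symmetric] transpose_matrix_vector dot_lmul_matrix)
  then show ?thesis by (simp add: inner_vec_def diagonal_matrix_vector_nth power2_eq_square algebra_simps)
qed

lemma sum_squares_orthogonal_coordinates:
  assumes "orthogonal_matrix (Q::real^'n^'n)"
  shows "(\<Sum>l\<in>UNIV. ((transpose Q *v x) $ l)\<^sup>2) = x \<bullet> x"
  using inner_spectral_matrix[of x Q "\<lambda>_. 1"] assms by (simp add: spectral_matrix_const)

section \<open>Volumes of ellipsoids\<close>

text \<open>The derivative of \<open>det (I + t M)\<close> at \<open>t = 0\<close> is the trace of \<open>M\<close>.\<close>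

lemma det_identity_perturbation_gt_1:
  fixes M :: "real^'n^'n"
  assumes sym: "transpose M = M" and tr: "0 < trace M"
  obtains h where "0 < h" "\<And>t. 0 < t \<Longrightarrow> t < h \<Longrightarrow> 1 < det (mat 1 + t *\<^sub>R M)"
proof -
  obtain Q d where Q: "orthogonal_matrix Q" and M: "M = spectral_matrix Q d"
    using spectral_theorem[OF sym] .
  define f where "f t = (\<Prod>l\<in>UNIV. 1 + t * d l)" for t
  have det: "det (mat 1 + t *\<^sub>R M) = f t" for t
    unfolding M spectral_matrix_const[OF Q, symmetric] f_def
    by (simp add: spectral_matrix_scaleR spectral_matrix_add det_spectral_matrix[OF Q])
  have "(f has_real_derivative (\<Sum>l\<in>UNIV. d l)) (at 0)"
    unfolding f_def by (rule has_field_derivative_prod[THEN DERIV_cong]) (auto intro!: derivative_eq_intros)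
  moreover have "0 < (\<Sum>l\<in>UNIV. d l)" using tr by (simp add: M trace_spectral_matrix[OF Q])
  ultimately obtain h where "0 < h" "\<And>t. 0 < t \<Longrightarrow> t < h \<Longrightarrow> f 0 < f (0 + t)"
    using DERIV_pos_inc_right by blast
  then show ?thesis using that by (simp add: det f_def)
qed

lemma nn_integral_lborel_reflect_translate:
  fixes f :: "'a::euclidean_space \<Rightarrow> ennreal"
  assumes [measurable]: "f \<in> borel_measurable borel" and c: "\<bar>c\<bar> = 1"
  shows "(\<integral>\<^sup>+x. f (t + c *\<^sub>R x) \<partial>lborel) = (\<integral>\<^sup>+x. f x \<partial>lborel)"
proof -
  have "(lborel :: 'a measure) = distr lborel borel (\<lambda>x. t + c *\<^sub>R x)"
    using lborel_affine[of c t] c by (auto simp: density_1)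
  then have "(\<integral>\<^sup>+x. f x \<partial>lborel) = (\<integral>\<^sup>+x. f x \<partial>distr lborel borel (\<lambda>x. t + c *\<^sub>R x))"
    by simp
  then show ?thesis by (simp add: nn_integral_distr)
qed

lemma orthogonal_matrix_vector_cancel:
  fixes Q :: "real^'n^'n"
  assumes "orthogonal_matrix Q"
  shows "Q *v (transpose Q *v x) = x" "transpose Q *v (Q *v x) = x"
  using assms by (simp_all add: matrix_vector_mul_assoc orthogonal_matrix_def del: transpose_matrix_vector)

lemma norm_orthogonal_matrix_vector:
  fixes Q :: "real^'n^'n"
  assumes "orthogonal_matrix Q"
  shows "norm (Q *v x) = norm x"
  using assms orthogonal_transformation_norm[of "(*v) Q"] by (simp add: orthogonal_transformation_matrix)

text \<open>Let \<open>\<beta>\<close> be the volume of the ball \<open>B\<close> and \<open>R\<close> the inverse of \<open>Q\<close>.  The double integral of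
  \<open>1\<^sub>S(x) 1\<^sub>B(R y + x)\<close> equals \<open>vol S * \<beta>\<close> when \<open>y\<close> is integrated first, because \<open>Q\<close> preserves the
  ball.  Translating \<open>x\<close> by \<open>- R y\<close> turns it into the integral of \<open>1\<^sub>S(x - R y) 1\<^sub>B(x)\<close>, which is
  \<open>vol (Q S) * \<beta>\<close> by invariance under translation and reflection in \<open>y\<close>.\<close>

lemma emeasure_lborel_orthogonal_image:
  fixes Q :: "real^'n^'n"
  assumes Q: "orthogonal_matrix Q" and S [measurable]: "S \<in> sets borel"
  shows "emeasure lborel ((*v) Q ` S) = emeasure lborel S"
proof -
  define R where "R = transpose Q"
  have R: "orthogonal_matrix R" using Q by (simp add: R_def)
  have QR: "Q *v (R *v x) = x" "R *v (Q *v x) = x" for x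
    using orthogonal_matrix_vector_cancel[OF Q] by (simp_all add: R_def)
  have [measurable]: "(\<lambda>x. R *v x) \<in> borel_measurable borel"
    by (intro borel_measurable_continuous_onI linear_continuous_on matrix_vector_mul_bounded_linear)
  have QS: "(*v) Q ` S = (\<lambda>x. R *v x) -` S"
    by (auto simp: QR image_iff) (metis QR(1))
  have [measurable]: "(*v) Q ` S \<in> sets borel"
    unfolding QS using measurable_sets[of "\<lambda>x. R *v x" borel borel S] by simp
  let ?B = "cball (0::real^'n) 1"
  have [measurable]: "?B \<in> sets borel" by simp
  define \<beta> where "\<beta> = emeasure lborel ?B"
  have "(\<integral>\<^sup>+y. indicator ?B (R *v y + x) \<partial>lborel) = \<beta>" for x
  proof -
    have "norm (R *v y + x) = norm (Q *v x + y)" for y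
      by (metis QR(1) R_def add.commute matrix_vector_right_distrib norm_orthogonal_matrix_vector[OF Q])
    then have "(\<integral>\<^sup>+y. indicator ?B (R *v y + x) \<partial>lborel) = (\<integral>\<^sup>+y. indicator ?B (Q *v x + 1 *\<^sub>R y) \<partial>lborel)"
      by (intro nn_integral_cong) (simp add: indicator_def)
    also have "\<dots> = \<beta>"
      by (subst nn_integral_lborel_reflect_translate) (auto simp: \<beta>_def)
    finally show ?thesis .
  qed
  then have "emeasure lborel S * \<beta> = (\<integral>\<^sup>+x. indicator S x * (\<integral>\<^sup>+y. indicator ?B (R *v y + x) \<partial>lborel) \<partial>lborel)"
    by (simp add: nn_integral_multc)
  also have "\<dots> = (\<integral>\<^sup>+x. (\<integral>\<^sup>+y. indicator S x * indicator ?B (R *v y + x) \<partial>lborel) \<partial>lborel)"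
    by (simp add: nn_integral_cmult)
  also have "\<dots> = (\<integral>\<^sup>+y. (\<integral>\<^sup>+x. indicator S x * indicator ?B (R *v y + x) \<partial>lborel) \<partial>lborel)"
    by (rule lborel_pair.Fubini'[of "\<lambda>x y. indicator S x * indicator ?B (R *v y + x)", symmetric])
      (simp add: borel_prod)
  also have "\<dots> = (\<integral>\<^sup>+y. (\<integral>\<^sup>+x. indicator S (x - R *v y) * indicator ?B x \<partial>lborel) \<partial>lborel)"
  proof (rule nn_integral_cong)
    fix y
    show "(\<integral>\<^sup>+x. indicator S x * indicator ?B (R *v y + x) \<partial>lborel) = (\<integral>\<^sup>+x. indicator S (x - R *v y) * indicator ?B x \<partial>lborel)"
      using nn_integral_lborel_reflect_translate[of "\<lambda>x. indicator S (x - R *v y) * indicator ?B x" 1 "R *v y"]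
      by simp
  qed
  also have "\<dots> = (\<integral>\<^sup>+x. (\<integral>\<^sup>+y. indicator S (x - R *v y) * indicator ?B x \<partial>lborel) \<partial>lborel)"
    by (rule lborel_pair.Fubini'[of "\<lambda>x y. indicator S (x - R *v y) * indicator ?B x"])
      (simp add: borel_prod)
  also have "\<dots> = (\<integral>\<^sup>+x. indicator ?B x * (\<integral>\<^sup>+y. indicator S (x - R *v y) \<partial>lborel) \<partial>lborel)"
    by (intro nn_integral_cong, subst mult.commute, rule nn_integral_cmult) measurable
  also have "\<dots> = (\<integral>\<^sup>+x. indicator ?B x * emeasure lborel ((*v) Q ` S) \<partial>lborel)"
  proof (intro nn_integral_cong arg_cong2[where f="(*)"] refl)
    fix x
    have "x - R *v y \<in> S \<longleftrightarrow> Q *v x + (-1) *\<^sub>R y \<in> (*v) Q ` S" for y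
      unfolding QS by (simp add: matrix_vector_mult_diff_distrib QR)
    then have "(\<integral>\<^sup>+y. indicator S (x - R *v y) \<partial>lborel) = (\<integral>\<^sup>+y. indicator ((*v) Q ` S) (Q *v x + (-1) *\<^sub>R y) \<partial>lborel)"
      by (intro nn_integral_cong) (simp add: indicator_def)
    also have "\<dots> = emeasure lborel ((*v) Q ` S)"
      by (subst nn_integral_lborel_reflect_translate) auto
    finally show "(\<integral>\<^sup>+y. indicator S (x - R *v y) \<partial>lborel) = emeasure lborel ((*v) Q ` S)" .
  qed
  also have "\<dots> = emeasure lborel ((*v) Q ` S) * \<beta>"
    by (simp add: nn_integral_multc \<beta>_def mult.commute)
  finally have "emeasure lborel S * \<beta> = emeasure lborel ((*v) Q ` S) * \<beta>" .
  moreover have "\<beta> \<noteq> 0" "\<beta> \<noteq> \<infinity>"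
    unfolding \<beta>_def by (simp_all add: emeasure_cball less_imp_neq[OF unit_ball_vol_pos, symmetric])
  ultimately show ?thesis by (metis ennreal_mult_divide_eq infinity_ennreal_def)
qed

text \<open>With \<open>T = Q D Q\<^sup>T\<close> the rotation \<open>Q\<^sup>T\<close> fixes the ball, the diagonal map \<open>D\<close> stretches it, and \<open>Q\<close>
  preserves the volume of the result.\<close>

lemma measure_symmetric_image_ball:
  fixes T :: "real^'n^'n"
  assumes "transpose T = T"
  shows "measure lebesgue ((*v) T ` cball 0 1) = \<bar>det T\<bar> * measure lebesgue (cball 0 1 :: (real^'n) set)"
proof -
  obtain Q d where Q: "orthogonal_matrix Q" and T: "T = spectral_matrix Q d"
    using spectral_theorem[OF assms] by blast
  define D :: "real^'n \<Rightarrow> real^'n" where "D x = (\<chi> k. d k * x $ k)" for x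
  have TD: "T *v x = Q *v D (transpose Q *v x)" for x
  proof -
    have "D y = (\<chi> i j. if i = j then d i else 0) *v y" for y
      by (simp add: D_def vec_eq_iff diagonal_matrix_vector_nth)
    then show ?thesis by (simp add: T spectral_matrix_def matrix_vector_mul_assoc matrix_mul_assoc)
  qed
  have ball: "(*v) (transpose Q) ` cball 0 1 = cball 0 1"
  proof (intro equalityI subsetI)
    fix x :: "real^'n" assume "x \<in> cball 0 1"
    then have "x = transpose Q *v (Q *v x)" "Q *v x \<in> cball 0 1"
      by (simp_all add: orthogonal_matrix_vector_cancel[OF Q] norm_orthogonal_matrix_vector[OF Q])
    then show "x \<in> (*v) (transpose Q) ` cball 0 1" by blast
  qed (use norm_orthogonal_matrix_vector[of "transpose Q"] Q in auto)
  have "(*v) T ` cball 0 1 = (*v) Q ` (D ` ((*v) (transpose Q) ` cball 0 1))"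
    unfolding image_image TD ..
  then have image: "(*v) T ` cball 0 1 = (*v) Q ` (D ` cball 0 1)" unfolding ball .
  have "continuous_on (cball 0 1) D"
    unfolding D_def by (intro continuous_intros)
  then have "compact (D ` cball 0 1)" by (rule compact_continuous_image) simp
  then have S: "D ` cball 0 1 \<in> sets borel" by (rule borel_compact)
  have QS: "(*v) Q ` (D ` cball 0 1) \<in> sets borel"
    by (intro borel_compact compact_continuous_image \<open>compact (D ` cball 0 1)\<close>
        linear_continuous_on matrix_vector_mul_bounded_linear)
  have "measure lebesgue ((*v) T ` cball 0 1) = measure lebesgue (D ` cball 0 1)"
    unfolding image using emeasure_lborel_orthogonal_image[OF Q S] S QS by (simp add: measure_def)
  also have "\<dots> = \<bar>prod d UNIV\<bar> * measure lebesgue (cball 0 1 :: (real^'n) set)"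
    unfolding D_def by (rule measure_stretch) simp
  finally show ?thesis by (simp add: T det_spectral_matrix[OF Q])
qed

section \<open>Contact points of the maximal ellipsoid\<close>

lemma norm_bounded_by_euclidean:
  fixes N :: "real^'n \<Rightarrow> real"
  assumes N: "is_norm N" and ball: "cball 0 1 \<subseteq> unit_ball N"
  shows "N x \<le> norm x"
proof (cases "x = 0")
  case True
  moreover have "N 0 = 0" using N unfolding is_norm_def by blast
  ultimately show ?thesis by simp
next
  case False
  have "N ((1 / norm x) *\<^sub>R x) \<le> 1"
    using subsetD[OF ball, of "(1 / norm x) *\<^sub>R x"] False by (simp add: unit_ball_def)
  then show ?thesis using N False by (simp add: is_norm_def field_simps)
qed

lemma closed_convex_unit_ball:
  fixes N :: "real^'n \<Rightarrow> real"
  assumes N: "is_norm N" and ball: "cball 0 1 \<subseteq> unit_ball N"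
  shows "closed (unit_ball N)" "convex (unit_ball N)"
proof -
  have tri: "N (x + y) \<le> N x + N y" and sc: "N (c *\<^sub>R x) = \<bar>c\<bar> * N x" for x y c
    using N by (auto simp: is_norm_def)
  have "N x - N y \<le> norm (x - y)" for x y
    using tri[of "x - y" y] norm_bounded_by_euclidean[OF assms, of "x - y"] by simp
  then have "\<bar>N x - N y\<bar> \<le> norm (x - y)" for x y
    by (metis abs_le_iff minus_diff_eq norm_minus_commute)
  then have "continuous_on UNIV N"
    unfolding continuous_on_iff dist_norm by (metis order_le_less_trans real_norm_def)
  then show "closed (unit_ball N)"
    unfolding unit_ball_def by (intro closed_Collect_le) auto
  show "convex (unit_ball N)"
  proof (rule convexI)
    fix x y and u v :: real
    assume *: "x \<in> unit_ball N" "y \<in> unit_ball N" "0 \<le> u" "0 \<le> v" "u + v = 1"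
    have "N (u *\<^sub>R x + v *\<^sub>R y) \<le> u * N x + v * N y"
      using tri[of "u *\<^sub>R x" "v *\<^sub>R y"] * by (simp add: sc)
    also have "\<dots> \<le> u * 1 + v * 1"
      using * by (intro add_mono mult_left_mono) (auto simp: unit_ball_def)
    finally show "u *\<^sub>R x + v *\<^sub>R y \<in> unit_ball N" using * by (simp add: unit_ball_def)
  qed
qed

text \<open>If the norm of \<open>u\<close> were smaller than 1, then \<open>u / N u\<close> would be a point of the unit ball of \<open>N\<close>
  beyond the supporting hyperplane.\<close>

lemma contact_point_if_supported:
  fixes N :: "real^'n \<Rightarrow> real"
  assumes N: "is_norm N" and ball: "cball 0 1 \<subseteq> unit_ball N"
    and u: "norm u = 1" and supp: "\<And>y. N y \<le> 1 \<Longrightarrow> y \<bullet> u \<le> 1"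
  shows "contact_point N u"
proof -
  have sc: "N (c *\<^sub>R x) = \<bar>c\<bar> * N x" for x c using N by (auto simp: is_norm_def)
  have nz: "N u \<noteq> 0" using N u by (auto simp: is_norm_def)
  have "0 \<le> N u"
  proof -
    have "N (u + (-1) *\<^sub>R u) \<le> N u + N ((-1) *\<^sub>R u)" "N 0 = 0"
      using N unfolding is_norm_def by blast+
    then show ?thesis using sc[of "-1" u] by simp
  qed
  then have pos: "0 < N u" using nz by simp
  have "N ((1 / N u) *\<^sub>R u) \<le> 1" using pos by (simp add: sc)
  from supp[OF this] have "1 / N u \<le> 1" using u by (simp add: norm_eq_1)
  then have "1 \<le> N u" using pos by (simp add: field_simps)
  then show ?thesis
    using norm_bounded_by_euclidean[OF N ball, of u] u by (simp add: contact_point_def)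
qed

text \<open>The ellipsoid \<open>T B\<close> has volume larger than that of the ball, so it has a point \<open>T y\<close> outside the
  unit ball of \<open>N\<close>.  A hyperplane separating this point from the unit ball has normal \<open>u\<close>, and
  \<open>T y \<bullet> u = y \<bullet> T u\<close> is at most the norm of \<open>T u\<close>.\<close>

lemma support_direction_of_larger_ellipsoid:
  fixes N :: "real^'n \<Rightarrow> real"
  assumes N: "is_norm N" and max: "max_volume_ellipsoid (cball 0 1) (unit_ball N)"
    and sym: "transpose T = T" and det: "1 < det T"
  shows "\<exists>u. norm u = 1 \<and> (\<forall>y. N y \<le> 1 \<longrightarrow> y \<bullet> u < norm (T *v u))"
proof -
  have ball: "cball 0 1 \<subseteq> unit_ball N"
    and vol: "\<And>F. ellipsoid F \<Longrightarrow> F \<subseteq> unit_ball N \<Longrightarrow> measure lebesgue F \<le> measure lebesgue (cball 0 1 :: (real^'n) set)"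
    using max by (auto simp: max_volume_ellipsoid_def)
  define F where "F = (*v) T ` cball 0 1"
  have lin: "linear ((*v) T)" by simp
  have "invertible T" using det by (simp add: invertible_det_nz)
  then have "bij ((*v) T)" by (simp add: invertible_eq_bij)
  then have "ellipsoid F"
    unfolding ellipsoid_def F_def using lin by (intro exI[of _ 0] exI[of _ "(*v) T"]) simp
  moreover have "measure lebesgue F = det T * measure lebesgue (cball 0 1 :: (real^'n) set)"
    unfolding F_def using det by (simp add: measure_symmetric_image_ball[OF sym])
  moreover have "0 < measure lebesgue (cball 0 1 :: (real^'n) set)"
    by (simp add: content_cball_pos)
  ultimately have "\<not> F \<subseteq> unit_ball N" using vol[of F] det by (auto simp: mult_le_cancel_right1 not_less)
  then obtain z where "z \<in> F" "z \<notin> unit_ball N" by blast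
  then obtain y where y: "norm y \<le> 1" "T *v y \<notin> unit_ball N" by (auto simp: F_def)
  obtain a b where ab: "a \<bullet> (T *v y) < b" "\<And>x. x \<in> unit_ball N \<Longrightarrow> b < a \<bullet> x"
    using separating_hyperplane_closed_point[OF closed_convex_unit_ball(2,1)[OF N ball] y(2)] by blast
  have "0 \<in> unit_ball N" using ball by auto
  then have "b < 0" using ab(2) by fastforce
  then have "a \<noteq> 0" using ab(1) by auto
  define u where "u = (- 1 / norm a) *\<^sub>R a"
  have "norm u = 1" using \<open>a \<noteq> 0\<close> by (simp add: u_def)
  moreover have "z \<bullet> u < norm (T *v u)" if "N z \<le> 1" for z
  proof -
    have "a \<bullet> (T *v y) < a \<bullet> z" using ab that by (force simp: unit_ball_def)
    then have "z \<bullet> u < (T *v y) \<bullet> u"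
      using \<open>a \<noteq> 0\<close> by (simp add: u_def inner_commute divide_strict_right_mono)
    also have "\<dots> = y \<bullet> (T *v u)" by (metis symmetric_inner_commute[OF sym] inner_commute)
    also have "\<dots> \<le> norm y * norm (T *v u)" by (rule norm_cauchy_schwarz)
    also have "\<dots> \<le> norm (T *v u)" using y(1) by (simp add: mult_left_le_one_le)
    finally show ?thesis .
  qed
  ultimately show ?thesis by blast
qed

text \<open>For \<open>t\<^sub>m\<close> tending to 0 let \<open>u\<^sub>m\<close> be unit normals of hyperplanes that separate the unit ball of \<open>N\<close>
  from a point of \<open>(I + t\<^sub>m M) B\<close>.  A limit point \<open>v\<close> of the \<open>u\<^sub>m\<close> is the normal of a hyperplane
  that supports both unit balls, so it is a contact point.  As \<open>u\<^sub>m\<close> itself lies in the unit ball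
  of \<open>N\<close>, the vector \<open>u\<^sub>m + t\<^sub>m M u\<^sub>m\<close> is longer than 1; to first order in \<open>t\<^sub>m\<close> this says
  \<open>u\<^sub>m \<bullet> M u\<^sub>m \<ge> 0\<close>, and passing to the limit gives the claim.\<close>

theorem contact_point_with_nonneg_form:
  fixes N :: "real^'n \<Rightarrow> real"
  assumes N: "is_norm N" and max: "max_volume_ellipsoid (cball 0 1) (unit_ball N)"
    and sym: "transpose M = M" and tr: "0 < trace M"
  shows "\<exists>u. contact_point N u \<and> 0 \<le> u \<bullet> (M *v u)"
proof -
  have ball: "cball 0 1 \<subseteq> unit_ball N" using max by (simp add: max_volume_ellipsoid_def)
  obtain h where h: "0 < h" "\<And>t. 0 < t \<Longrightarrow> t < h \<Longrightarrow> 1 < det (mat 1 + t *\<^sub>R M)"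
    using det_identity_perturbation_gt_1[OF sym tr] by blast
  \<comment> \<open>the shift by 2 keeps \<open>t m\<close> strictly below \<open>h\<close>\<close>
  define t where "t m = h / real (m + 2)" for m
  have t: "0 < t m" "t m < h" for m using h(1) by (auto simp: t_def field_simps intro: add_pos_nonneg)
  have t0: "t \<longlonglongrightarrow> 0"
    unfolding t_def by (rule LIMSEQ_ignore_initial_segment) (rule lim_const_over_n)
  have T: "(mat 1 + c *\<^sub>R M) *v x = x + c *\<^sub>R (M *v x)" for c x
    by (simp add: matrix_vector_mult_add_rdistrib scaleR_matrix_vector_assoc)
  have "transpose (mat 1 + c *\<^sub>R M) = mat 1 + c *\<^sub>R M" for c
  proof -
    have "M $ i $ j = M $ j $ i" for i j using arg_cong[OF sym, of "\<lambda>A. A $ j $ i"] by (simp add: transpose_def)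
    then show ?thesis by (simp add: vec_eq_iff transpose_def mat_def)
  qed
  then have "\<exists>u. norm u = 1 \<and> (\<forall>y. N y \<le> 1 \<longrightarrow> y \<bullet> u < norm (u + t m *\<^sub>R (M *v u)))" for m
    using support_direction_of_larger_ellipsoid[OF N max _ h(2)[OF t[of m]]] unfolding T by blast
  then have "\<forall>m. \<exists>u. norm u = 1 \<and> (\<forall>y. N y \<le> 1 \<longrightarrow> y \<bullet> u < norm (u + t m *\<^sub>R (M *v u)))"
    by blast
  from choice[OF this] obtain u where u: "\<And>m. norm (u m) = 1"
    and less: "\<And>m y. N y \<le> 1 \<Longrightarrow> y \<bullet> u m < norm (u m + t m *\<^sub>R (M *v u m))"
    by blast
  have "compact (sphere (0::real^'n) 1)" by simp
  then obtain v r where v: "norm v = 1" and r: "strict_mono r" and lim: "(u \<circ> r) \<longlonglongrightarrow> v"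
    using u unfolding compact_def by (metis mem_sphere_0)
  have ur: "(\<lambda>m. u (r m)) \<longlonglongrightarrow> v" using lim by (simp add: o_def)
  have tr0: "(\<lambda>m. t (r m)) \<longlonglongrightarrow> 0" using LIMSEQ_subseq_LIMSEQ[OF t0 r] by (simp add: o_def)
  have Mur: "(\<lambda>m. M *v u (r m)) \<longlonglongrightarrow> M *v v"
    by (rule bounded_linear.tendsto[OF matrix_vector_mul_bounded_linear ur])
  have "contact_point N v"
  proof (rule contact_point_if_supported[OF N ball v])
    fix y assume y: "N y \<le> 1"
    have "(\<lambda>m. norm (u (r m) + t (r m) *\<^sub>R (M *v u (r m)))) \<longlonglongrightarrow> norm (v + 0 *\<^sub>R (M *v v))"
      by (intro tendsto_intros ur tr0 Mur)
    moreover have "(\<lambda>m. y \<bullet> u (r m)) \<longlonglongrightarrow> y \<bullet> v" by (intro tendsto_intros ur)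
    ultimately have "y \<bullet> v \<le> norm (v + 0 *\<^sub>R (M *v v))"
      using less[OF y] by (intro LIMSEQ_le) (auto intro: less_imp_le)
    then show "y \<bullet> v \<le> 1" using v by simp
  qed
  moreover have "0 \<le> v \<bullet> (M *v v)"
  proof -
    have "0 \<le> 2 * (u m \<bullet> (M *v u m)) + t m * ((M *v u m) \<bullet> (M *v u m))" for m
    proof -
      have uu: "u m \<bullet> u m = 1" using u by (simp add: norm_eq_1)
      have "N (u m) \<le> 1" using norm_bounded_by_euclidean[OF N ball, of "u m"] u by simp
      from less[OF this, of m] have "1 < norm (u m + t m *\<^sub>R (M *v u m))" by (simp add: uu)
      then have "1 < (norm (u m + t m *\<^sub>R (M *v u m)))\<^sup>2" by (simp add: one_less_power)
      also have "\<dots> = 1 + t m * (2 * (u m \<bullet> (M *v u m)) + t m * ((M *v u m) \<bullet> (M *v u m)))"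
        unfolding power2_norm_eq_inner
        by (simp add: inner_add_left inner_add_right uu algebra_simps inner_commute)
      finally show ?thesis using t[of m] by (simp add: zero_less_mult_iff)
    qed
    moreover have "(\<lambda>m. 2 * (u (r m) \<bullet> (M *v u (r m))) + t (r m) * ((M *v u (r m)) \<bullet> (M *v u (r m))))
        \<longlonglongrightarrow> 2 * (v \<bullet> (M *v v)) + 0 * ((M *v v) \<bullet> (M *v v))"
      by (intro tendsto_intros ur tr0 Mur)
    ultimately have "0 \<le> 2 * (v \<bullet> (M *v v)) + 0 * ((M *v v) \<bullet> (M *v v))"
      by (intro LIMSEQ_le_const) auto
    then show ?thesis by simp
  qed
  ultimately show ?thesis by blast
qed

section \<open>Resolvents and rank-one updates\<close>

lemma column_orthogonal_matrix_norm:
  fixes Q :: "real^'n^'n"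
  assumes "orthogonal_matrix Q"
  shows "norm (column l Q) = 1"
  using assms by (simp add: orthogonal_matrix_orthonormal_columns)

lemma spectral_matrix_eigenvector:
  fixes Q :: "real^'n^'n"
  assumes Q: "orthogonal_matrix Q"
  shows "spectral_matrix Q d *v column l Q = d l *\<^sub>R column l Q"
proof -
  let ?D = "(\<chi> i j. if i = j then d i else 0) :: real^'n^'n"
  have "spectral_matrix Q d *v column l Q = spectral_matrix Q d *v (Q *v axis l 1)"
    by (simp add: matrix_vector_mult_basis)
  also have "\<dots> = Q *v (?D *v (transpose Q *v (Q *v axis l 1)))"
    unfolding spectral_matrix_def by (simp add: matrix_vector_mul_assoc matrix_mul_assoc)
  also have "\<dots> = Q *v (?D *v axis l 1)"
    by (simp add: orthogonal_matrix_vector_cancel[OF Q])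
  also have "?D *v axis l 1 = d l *\<^sub>R axis l 1"
    by (simp add: vec_eq_iff diagonal_matrix_vector_nth axis_def)
  finally show ?thesis by (simp add: matrix_vector_mult_scaleR matrix_vector_mult_basis)
qed

definition outer :: "real^'n \<Rightarrow> real^'n^'n" where
  "outer v = (\<chi> i j. v $ i * v $ j)"

lemma outer_vector: "outer v *v x = (v \<bullet> x) *\<^sub>R v"
  by (simp add: vec_eq_iff outer_def matrix_vector_mult_def inner_vec_def sum_distrib_left mult_ac)

lemma trace_outer: "trace (outer v) = v \<bullet> v"
  by (simp add: trace_def outer_def inner_vec_def)

lemma transpose_outer: "transpose (outer v) = outer v"
  by (simp add: vec_eq_iff transpose_def outer_def mult.commute)

definition resolvent :: "real \<Rightarrow> real^'n^'n \<Rightarrow> real^'n^'n" where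
  "resolvent c A = matrix_inv (mat c - A)"

lemma resolvent_eqI:
  fixes A R :: "real^'n^'n"
  assumes "(mat c - A) ** R = mat 1"
  shows "resolvent c A = R"
proof -
  have left: "R ** (mat c - A) = mat 1" using assms matrix_left_right_inverse by blast
  show ?thesis unfolding resolvent_def matrix_inv_def
  proof (rule some_equality)
    fix X assume "(mat c - A) ** X = mat 1 \<and> X ** (mat c - A) = mat 1"
    then have "R ** ((mat c - A) ** X) = R" by simp
    then show "X = R" unfolding matrix_mul_assoc left by simp
  qed (use assms left in blast)
qed

lemma spectral_inverse:
  fixes Q :: "real^'n^'n"
  assumes Q: "orthogonal_matrix Q" and c: "\<And>l. d l \<noteq> c"
  shows "(mat c - spectral_matrix Q d) ** spectral_matrix Q (\<lambda>l. 1 / (c - d l)) = mat 1"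
  unfolding spectral_matrix_const[OF Q, symmetric] spectral_matrix_diff spectral_matrix_mult[OF Q]
  using c by (intro arg_cong[where f="spectral_matrix Q"]) (auto simp: fun_eq_iff)

lemma resolvent_spectral_matrix:
  fixes Q :: "real^'n^'n"
  assumes "orthogonal_matrix Q" and "\<And>l. d l \<noteq> c"
  shows "resolvent c (spectral_matrix Q d) = spectral_matrix Q (\<lambda>l. 1 / (c - d l))"
  by (rule resolvent_eqI[OF spectral_inverse[OF assms]])

text \<open>The Sherman-Morrison formula: with \<open>R = (c - A)\<inverse>\<close>, the inverse of \<open>c - A - v v\<^sup>T\<close> is
  \<open>R + (R v) (R v)\<^sup>T / (1 - v \<bullet> R v)\<close>.\<close>

lemma trace_resolvent_rank_one_update:
  fixes A R :: "real^'n^'n"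
  assumes inv: "(mat c - A) ** R = mat 1" and sym: "transpose R = R" and ne: "v \<bullet> (R *v v) \<noteq> 1"
  shows "trace (resolvent c (A + outer v)) = trace R + ((R *v v) \<bullet> (R *v v)) / (1 - v \<bullet> (R *v v))"
proof -
  define k where "k = 1 / (1 - v \<bullet> (R *v v))"
  have k: "k * (1 - v \<bullet> (R *v v)) = 1" using ne by (simp add: k_def)
  define B where "B = mat c - A"
  have Bv: "B *v (R *v x) = x" for x
    by (simp add: matrix_vector_mul_assoc inv B_def)
  have "(mat c - (A + outer v)) ** (R + k *\<^sub>R outer (R *v v)) = mat 1"
    unfolding matrix_eq
  proof
    fix x
    have s: "v \<bullet> (R *v x) = (R *v v) \<bullet> x"
      by (metis symmetric_inner_commute[OF sym] inner_commute)
    have "((mat c - (A + outer v)) ** (R + k *\<^sub>R outer (R *v v))) *v x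
        = (B - outer v) *v (R *v x + (k * ((R *v v) \<bullet> x)) *\<^sub>R (R *v v))"
      by (simp add: matrix_vector_mul_assoc[symmetric] matrix_vector_mult_add_rdistrib
          scaleR_matrix_vector_assoc[symmetric] outer_vector diff_diff_eq B_def)
    also have "\<dots> = x + (k * ((R *v v) \<bullet> x)) *\<^sub>R v
        - (((R *v v) \<bullet> x) *\<^sub>R v + (k * ((R *v v) \<bullet> x) * (v \<bullet> (R *v v))) *\<^sub>R v)"
      by (simp add: matrix_vector_mult_diff_rdistrib matrix_vector_right_distrib matrix_vector_mult_scaleR
          Bv outer_vector s scaleR_diff_right)
    also have "\<dots> = x + (((R *v v) \<bullet> x) * (k * (1 - v \<bullet> (R *v v)) - 1)) *\<^sub>R v"
      by (simp add: algebra_simps)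
    finally show "((mat c - (A + outer v)) ** (R + k *\<^sub>R outer (R *v v))) *v x = mat 1 *v x"
      by (simp add: k)
  qed
  then have "resolvent c (A + outer v) = R + k *\<^sub>R outer (R *v v)" by (rule resolvent_eqI)
  moreover have "trace (k *\<^sub>R outer (R *v v)) = k * ((R *v v) \<bullet> (R *v v))"
    unfolding trace_outer[symmetric] by (simp add: trace_def sum_distrib_left)
  ultimately show ?thesis by (simp add: trace_add k_def)
qed

section \<open>Gram matrices with controlled spectrum\<close>

text \<open>With \<open>Y\<close> the matrix whose columns are \<open>y\<^sub>1, \<dots>, y\<^sub>k\<close>, this is \<open>Y Y\<^sup>T\<close>.  Its nonzero spectrum is that of
  the Gram matrix \<open>Y\<^sup>T Y\<close>, but its size does not change with \<open>k\<close>.\<close>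

definition frame :: "(nat \<Rightarrow> real^'n) \<Rightarrow> nat \<Rightarrow> real^'n^'n" where
  "frame y k = (\<Sum>j=1..k. outer (y j))"

lemma frame_0: "frame y 0 = 0"
  by (simp add: frame_def)

lemma frame_Suc: "frame (y(Suc k := v)) (Suc k) = frame y k + outer v"
proof -
  have "(\<Sum>j=1..k. outer ((y(Suc k := v)) j)) = (\<Sum>j=1..k. outer (y j))"
    by (rule sum.cong) auto
  then show ?thesis by (simp add: frame_def)
qed

lemma frame_vector: "frame y k *v x = (\<Sum>j=1..k. (y j \<bullet> x) *\<^sub>R y j)"
proof (induction k)
  case (Suc k)
  then show ?case
    by (simp add: frame_def matrix_vector_mult_add_rdistrib outer_vector)
qed (simp add: frame_def)

lemma inner_frame: "z \<bullet> (frame y k *v x) = (\<Sum>j=1..k. (y j \<bullet> z) * (y j \<bullet> x))"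
  by (simp add: frame_vector inner_sum_right inner_commute mult.commute)

lemma transpose_frame:
  fixes y :: "nat \<Rightarrow> real^'n"
  shows "transpose (frame y k) = frame y k"
proof (induction k)
  case 0
  show ?case by (simp add: frame_def transpose_def vec_eq_iff)
next
  case (Suc k)
  have "transpose (A + B) = transpose A + transpose B" for A B :: "real^'n^'n"
    by (simp add: transpose_def vec_eq_iff)
  with Suc show ?case by (simp add: frame_def transpose_outer)
qed

text \<open>The spectrum of the Gram matrix lies strictly between \<open>b\<close> and \<open>u\<close>.  The lower bound has to be
  stated for the Gram matrix, since \<open>Y Y\<^sup>T\<close> is singular for \<open>k < n\<close>; the upper bound is stated
  for \<open>Y Y\<^sup>T\<close>, where it is also meaningful for \<open>k = 0\<close>.\<close>

definition gram_between :: "(nat \<Rightarrow> real^'n) \<Rightarrow> nat \<Rightarrow> real \<Rightarrow> real \<Rightarrow> bool" where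
  "gram_between y k b u \<longleftrightarrow>
     (\<forall>a. (\<exists>j\<in>{1..k}. a j \<noteq> 0) \<longrightarrow> b * (\<Sum>j=1..k. (a j)\<^sup>2) < (norm (\<Sum>j=1..k. a j *\<^sub>R y j))\<^sup>2) \<and>
     (\<forall>z. z \<noteq> 0 \<longrightarrow> z \<bullet> (frame y k *v z) < u * (z \<bullet> z))"

lemma gram_between_0:
  assumes "0 < u"
  shows "gram_between y 0 b u"
  using assms by (simp add: gram_between_def frame_0)

lemma gram_between_mono:
  assumes "gram_between y k b u" "b' \<le> b" "u \<le> u'"
  shows "gram_between y k b' u'"
proof -
  have "b' * (\<Sum>j=1..k. (a j)\<^sup>2) \<le> b * (\<Sum>j=1..k. (a j)\<^sup>2)" for a
    using assms(2) by (intro mult_right_mono sum_nonneg) auto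
  moreover have "u * (z \<bullet> z) \<le> u' * (z \<bullet> z)" for z :: "real^'n"
    using assms(3) by (intro mult_right_mono) auto
  ultimately show ?thesis
    using assms(1) unfolding gram_between_def by (meson order_le_less_trans order_less_le_trans)
qed

text \<open>For a unit eigenvector \<open>e\<close> of \<open>Y Y\<^sup>T\<close> with eigenvalue \<open>\<lambda> \<noteq> 0\<close>, the coefficients \<open>a = Y\<^sup>T e\<close> satisfy
  \<open>Y a = \<lambda> e\<close> and have square sum \<open>\<lambda>\<close>, so the lower bound for the Gram matrix reads
  \<open>b \<lambda> < \<lambda>\<^sup>2\<close>.\<close>

lemma gram_between_spectrum:
  fixes Q :: "real^'n^'n"
  assumes gb: "gram_between y k b u"
    and Q: "orthogonal_matrix Q" and A: "frame y k = spectral_matrix Q d"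
  shows "0 \<le> d l" "d l < u" "d l = 0 \<or> b < d l"
proof -
  define e where "e = column l Q"
  have e: "e \<bullet> e = 1" using column_orthogonal_matrix_norm[OF Q] by (simp add: e_def norm_eq_1)
  then have "e \<noteq> 0" by auto
  have Ae: "frame y k *v e = d l *\<^sub>R e"
    unfolding A e_def by (rule spectral_matrix_eigenvector[OF Q])
  have d: "(\<Sum>j=1..k. (y j \<bullet> e)\<^sup>2) = d l"
    using inner_frame[of e y k e] by (simp add: Ae e power2_eq_square)
  then show nonneg: "0 \<le> d l" by (metis sum_nonneg zero_le_power2)
  show "d l < u"
  proof -
    have "e \<bullet> (frame y k *v e) < u * (e \<bullet> e)"
      using gb \<open>e \<noteq> 0\<close> unfolding gram_between_def by blast
    then show ?thesis by (simp add: Ae e)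
  qed
  show "d l = 0 \<or> b < d l"
  proof (cases "d l = 0")
    case False
    have sum: "(\<Sum>j=1..k. (y j \<bullet> e) *\<^sub>R y j) = d l *\<^sub>R e"
      using frame_vector[of y k e] Ae by simp
    have "\<exists>j\<in>{1..k}. y j \<bullet> e \<noteq> 0"
    proof (rule ccontr)
      assume "\<not> ?thesis"
      then have "(\<Sum>j=1..k. (y j \<bullet> e)\<^sup>2) = 0" by simp
      then show False using d False by simp
    qed
    then have "b * (\<Sum>j=1..k. (y j \<bullet> e)\<^sup>2) < (norm (\<Sum>j=1..k. (y j \<bullet> e) *\<^sub>R y j))\<^sup>2"
      using gb unfolding gram_between_def by (elim conjE allE[of _ "\<lambda>j. y j \<bullet> e"]) blast
    then have "b * d l < (norm (d l *\<^sub>R e))\<^sup>2" unfolding d sum .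
    then have "b * d l < d l * d l"
      unfolding power2_norm_eq_inner by (simp add: e)
    then show ?thesis using nonneg False by simp
  qed simp
qed

lemma mat_vector_mult:
  fixes x :: "real^'n"
  shows "mat c *v x = c *\<^sub>R x"
  by (simp add: matrix_vector_mult_def mat_def vec_eq_iff if_distrib[of "\<lambda>t. t * _"] cong: if_cong)

text \<open>Both bounds survive the addition of \<open>v\<close> by completing a square.

  For the lower one let \<open>w = (A - b)\<inverse> v\<close>, so that \<open>v = A w - b w\<close> and \<open>w \<bullet> v < - 1\<close>.  Given
  coefficients \<open>(a, c)\<close> put \<open>a' = a + c Y\<^sup>T w\<close>.  Then
  \<open>\<parallel>Y a + c v\<parallel>\<^sup>2 - b (\<parallel>a\<parallel>\<^sup>2 + c\<^sup>2) = (\<parallel>Y a'\<parallel>\<^sup>2 - b \<parallel>a'\<parallel>\<^sup>2) + b c\<^sup>2 (- (w \<bullet> v) - 1)\<close>,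
  a sum of two nonnegative terms that do not vanish together.

  For the upper one let \<open>F z = u \<parallel>z\<parallel>\<^sup>2 - z \<bullet> A z\<close>, a positive definite form, \<open>w = (u - A)\<inverse> v\<close> and
  \<open>c = v \<bullet> z\<close>.  Nonnegativity of \<open>F (z - c w)\<close> gives \<open>F z \<ge> c\<^sup>2 (2 - w \<bullet> v)\<close>, which exceeds \<open>c\<^sup>2\<close>.\<close>

lemma gram_between_extend:
  fixes y :: "nat \<Rightarrow> real^'n" and R R' :: "real^'n^'n"
  assumes gb: "gram_between y k b u" and b: "0 < b"
    and R: "(mat b - frame y k) ** R = mat 1" and v: "1 < v \<bullet> (R *v v)"
    and R': "(mat u - frame y k) ** R' = mat 1" and v': "v \<bullet> (R' *v v) < 1"
  shows "gram_between (y(Suc k := v)) (Suc k) b u"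
  unfolding gram_between_def frame_Suc
proof (intro conjI allI impI)
  define A where "A = frame y k"
  have A_form: "z \<bullet> (A *v x) = x \<bullet> (A *v z)" for x z
    unfolding A_def by (rule symmetric_inner_commute[OF transpose_frame])
  fix a :: "nat \<Rightarrow> real"
  assume ex: "\<exists>j\<in>{1..Suc k}. a j \<noteq> 0"
  define w where "w = - (R *v v)"
  define c where "c = a (Suc k)"
  define a' where "a' j = a j + c * (y j \<bullet> w)" for j
  have "(mat b - A) *v (R *v v) = v"
    unfolding A_def by (simp add: matrix_vector_mul_assoc R)
  then have vw: "v = A *v w - b *\<^sub>R w"
    by (simp add: w_def matrix_vector_mult_diff_rdistrib mat_vector_mult vec.neg)
  have wv: "w \<bullet> v < -1" using v by (simp add: w_def inner_commute)
  have sum_y: "(\<Sum>j=1..k. a j *\<^sub>R (y(Suc k := v)) j) = (\<Sum>j=1..k. a j *\<^sub>R y j)"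
    by (rule sum.cong) auto
  define Y where "Y = (\<Sum>j=1..k. a' j *\<^sub>R y j)"
  have "Y = (\<Sum>j=1..k. a j *\<^sub>R y j) + c *\<^sub>R (A *v w)"
    by (simp add: Y_def a'_def A_def frame_vector scaleR_add_left sum.distrib scaleR_sum_right)
  then have vec: "(\<Sum>j=1..Suc k. a j *\<^sub>R (y(Suc k := v)) j) = Y - (c * b) *\<^sub>R w"
    using sum_y by (simp add: vw c_def[symmetric] algebra_simps)
  have Yw: "Y \<bullet> w = (\<Sum>j=1..k. a' j * (y j \<bullet> w))"
    by (simp add: Y_def inner_sum_left)
  have wAw: "w \<bullet> (A *v w) = (\<Sum>j=1..k. (y j \<bullet> w)\<^sup>2)"
    by (simp add: A_def inner_frame power2_eq_square)
  have "(\<Sum>j=1..k. (a j)\<^sup>2) = (\<Sum>j=1..k. (a' j)\<^sup>2 - 2 * c * (a' j * (y j \<bullet> w)) + c\<^sup>2 * (y j \<bullet> w)\<^sup>2)"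
    by (intro sum.cong) (auto simp: a'_def power2_eq_square algebra_simps)
  then have sq: "(\<Sum>j=1..k. (a j)\<^sup>2) = (\<Sum>j=1..k. (a' j)\<^sup>2) - 2 * c * (Y \<bullet> w) + c\<^sup>2 * (w \<bullet> (A *v w))"
    by (simp add: sum.distrib sum_subtractf sum_distrib_left[symmetric] Yw wAw)
  have wv_eq: "w \<bullet> v = w \<bullet> (A *v w) - b * (w \<bullet> w)"
    by (subst vw) (simp add: inner_diff_right)
  have "(norm (Y - (c * b) *\<^sub>R w))\<^sup>2 = (norm Y)\<^sup>2 - 2 * (c * b) * (Y \<bullet> w) + (c * b)\<^sup>2 * (w \<bullet> w)"
    unfolding power2_norm_eq_inner
    by (simp add: inner_diff_left inner_diff_right inner_commute algebra_simps power2_eq_square)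
  then have key: "(norm (Y - (c * b) *\<^sub>R w))\<^sup>2 - b * ((\<Sum>j=1..k. (a j)\<^sup>2) + c\<^sup>2)
      = ((norm Y)\<^sup>2 - b * (\<Sum>j=1..k. (a' j)\<^sup>2)) + b * c\<^sup>2 * (- (w \<bullet> v) - 1)"
    unfolding sq wv_eq by (simp add: algebra_simps power2_eq_square)
  have Y_nonneg: "0 \<le> (norm Y)\<^sup>2 - b * (\<Sum>j=1..k. (a' j)\<^sup>2)"
  proof (cases "\<exists>j\<in>{1..k}. a' j \<noteq> 0")
    case True
    then show ?thesis using gb unfolding gram_between_def Y_def by (simp add: less_imp_le)
  next
    case False
    then show ?thesis by simp
  qed
  have "0 < ((norm Y)\<^sup>2 - b * (\<Sum>j=1..k. (a' j)\<^sup>2)) + b * c\<^sup>2 * (- (w \<bullet> v) - 1)"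
  proof (cases "c = 0")
    case True
    then have "a' = a" by (auto simp: a'_def)
    moreover have "\<exists>j\<in>{1..k}. a j \<noteq> 0"
      using ex True unfolding c_def by (metis atLeastAtMost_iff le_Suc_eq)
    ultimately show ?thesis using gb True unfolding gram_between_def Y_def by simp
  next
    case False
    then have "0 < b * c\<^sup>2 * (- (w \<bullet> v) - 1)" using b wv by simp
    then show ?thesis using Y_nonneg by linarith
  qed
  then show "b * (\<Sum>j=1..Suc k. (a j)\<^sup>2) < (norm (\<Sum>j=1..Suc k. a j *\<^sub>R (y(Suc k := v)) j))\<^sup>2"
    unfolding vec using key by (simp add: c_def)
next
  fix z :: "real^'n"
  assume "z \<noteq> 0"
  define A where "A = frame y k"
  define F where "F x = u * (x \<bullet> x) - x \<bullet> (A *v x)" for x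
  have F_pos: "0 < F x" if "x \<noteq> 0" for x
    using gb that by (simp add: F_def A_def gram_between_def)
  then have F_nonneg: "0 \<le> F x" for x by (cases "x = 0") (auto simp: F_def less_imp_le)
  define w where "w = R' *v v"
  define c where "c = v \<bullet> z"
  have "(mat u - A) *v w = v"
    unfolding A_def w_def by (simp add: matrix_vector_mul_assoc R')
  then have vw: "v = u *\<^sub>R w - A *v w"
    by (simp add: matrix_vector_mult_diff_rdistrib mat_vector_mult)
  have zA: "w \<bullet> (A *v z) = z \<bullet> (A *v w)"
    unfolding A_def by (rule symmetric_inner_commute[OF transpose_frame])
  have c_eq: "c = u * (z \<bullet> w) - z \<bullet> (A *v w)"
    unfolding c_def by (subst vw) (simp add: inner_commute[of _ z] inner_diff_right)
  have wv: "w \<bullet> v = u * (w \<bullet> w) - w \<bullet> (A *v w)"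
    by (subst vw) (simp add: inner_diff_right)
  have "F (z - c *\<^sub>R w) = F z - 2 * c * (u * (z \<bullet> w) - z \<bullet> (A *v w)) + c\<^sup>2 * (u * (w \<bullet> w) - w \<bullet> (A *v w))"
    unfolding F_def
    by (simp add: matrix_vector_mult_diff_distrib matrix_vector_mult_scaleR inner_diff_left inner_diff_right
        zA inner_commute[of w z] algebra_simps power2_eq_square)
  also have "\<dots> = F z - c\<^sup>2 * (2 - w \<bullet> v)"
    unfolding c_eq[symmetric] wv[symmetric] by (simp add: algebra_simps power2_eq_square)
  finally have "c\<^sup>2 * (2 - w \<bullet> v) \<le> F z" using F_nonneg[of "z - c *\<^sub>R w"] by simp
  moreover have "c\<^sup>2 * 1 < c\<^sup>2 * (2 - w \<bullet> v)" if "c \<noteq> 0"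
    using that v' by (intro mult_strict_left_mono) (auto simp: w_def inner_commute)
  ultimately have "c\<^sup>2 < F z"
    using F_pos[OF \<open>z \<noteq> 0\<close>] by (cases "c = 0") (simp, metis mult.right_neutral order_less_le_trans)
  then show "z \<bullet> ((frame y k + outer v) *v z) < u * (z \<bullet> z)"
    by (simp add: F_def A_def[symmetric] matrix_vector_mult_add_rdistrib outer_vector inner_add_right c_def
        power2_eq_square inner_commute)
qed

section \<open>Average cost of moving the barriers\<close>

text \<open>\<open>D\<close> is the decrease of the upper potential when the barrier moves from \<open>u\<close> to \<open>u + \<delta>\<close>.  The
  second bound limits the correction that the update formula for the trace adds to
  the form \<open>v \<bullet> (u + \<delta> - A)\<inverse> v\<close>, on average.\<close>

lemma upper_barrier_average:
  fixes d :: "'i::finite \<Rightarrow> real"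
  assumes d: "\<And>l. d l < u" and \<delta>: "0 < \<delta>"
  defines "D \<equiv> (\<Sum>l\<in>UNIV. 1 / (u - d l)) - (\<Sum>l\<in>UNIV. 1 / (u + \<delta> - d l))"
  shows "0 < D"
    and "(\<Sum>l\<in>UNIV. (1 / (u + \<delta> - d l))\<^sup>2) / D \<le> 1 / \<delta>"
proof -
  have D: "D = (\<Sum>l\<in>UNIV. 1 / (u - d l) - 1 / (u + \<delta> - d l))"
    by (simp add: D_def sum_subtractf)
  have bound: "\<delta> * (1 / (u + \<delta> - d l))\<^sup>2 \<le> 1 / (u - d l) - 1 / (u + \<delta> - d l)" for l
  proof -
    have pos: "0 < u - d l" "0 < u + \<delta> - d l" using d[of l] \<delta> by auto
    have "\<delta> * (1 / (u + \<delta> - d l))\<^sup>2 = \<delta> / ((u + \<delta> - d l) * (u + \<delta> - d l))"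
      by (simp add: power2_eq_square)
    also have "\<dots> \<le> \<delta> / ((u - d l) * (u + \<delta> - d l))"
      using pos \<delta> by (intro divide_left_mono mult_right_mono) auto
    also have "\<dots> = 1 / (u - d l) - 1 / (u + \<delta> - d l)"
      using pos by (simp add: field_simps)
    finally show ?thesis .
  qed
  have pos: "0 < (1 / (u + \<delta> - d l))\<^sup>2" for l
  proof -
    have "u + \<delta> - d l \<noteq> 0" using d[of l] \<delta> by linarith
    then show ?thesis by simp
  qed
  have le: "\<delta> * (\<Sum>l\<in>UNIV. (1 / (u + \<delta> - d l))\<^sup>2) \<le> D"
    unfolding D sum_distrib_left by (intro sum_mono bound)
  have "0 < (\<Sum>l\<in>UNIV. (1 / (u + \<delta> - d l))\<^sup>2)"
    by (rule sum_pos[OF _ _ pos]) simp_all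
  then have "0 < \<delta> * (\<Sum>l\<in>UNIV. (1 / (u + \<delta> - d l))\<^sup>2)" using \<delta> by simp
  with le show "0 < D" by linarith
  then show "(\<Sum>l\<in>UNIV. (1 / (u + \<delta> - d l))\<^sup>2) / D \<le> 1 / \<delta>"
    using le \<delta> by (simp add: field_simps)
qed

text \<open>\<open>D\<close> is the increase of the lower potential when the barrier moves from \<open>b\<close> down to \<open>b' = b - \<Delta>\<close>.
  Compared termwise with the increments \<open>g l\<close> of the potential, the squares \<open>1 / (b' - d l)\<^sup>2\<close> are at
  most \<open>g l / \<Delta>\<close> at the eigenvalues above \<open>b\<close>, but exceed it by \<open>\<Delta> / (b b'\<^sup>2)\<close> at the zero
  eigenvalues.  With \<open>p\<close> the number of zero eigenvalues divided by \<open>b\<close>, the total excess is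
  \<open>\<Delta> p / b'\<^sup>2\<close>.  The zero eigenvalues alone already contribute \<open>\<Delta> p / b'\<close> to \<open>D\<close>, and \<open>\<Delta> p \<ge> 1\<close>
  because the other eigenvalues only lower the potential; so the excess is at most \<open>D\<^sup>2\<close>.\<close>

lemma lower_barrier_average:
  fixes d :: "'i::finite \<Rightarrow> real"
  assumes d: "\<And>l. d l = 0 \<or> b < d l" and \<Delta>: "0 < \<Delta>" "\<Delta> < b"
    and large: "1 \<le> \<Delta> * (\<Sum>l\<in>UNIV. 1 / (b - d l))"
  defines "D \<equiv> (\<Sum>l\<in>UNIV. 1 / (b - \<Delta> - d l)) - (\<Sum>l\<in>UNIV. 1 / (b - d l))"
  shows "0 < D"
    and "(\<Sum>l\<in>UNIV. (1 / (b - \<Delta> - d l))\<^sup>2) / D \<le> D + 1 / \<Delta>"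
proof -
  define b' where "b' = b - \<Delta>"
  define g where "g l = 1 / (b' - d l) - 1 / (b - d l)" for l
  define Z where "Z = {l. d l = 0}"
  define p where "p = real (card Z) / b"
  have b: "0 < b" "0 < b'" "b' < b" using \<Delta> by (auto simp: b'_def)
  have D: "D = (\<Sum>l\<in>UNIV. g l)" by (simp add: D_def g_def b'_def sum_subtractf)
  have g_Z: "g l = \<Delta> / (b' * b)" if "l \<in> Z" for l
    using that b by (simp add: g_def Z_def b'_def field_simps)
  have g_alt: "g l = \<Delta> / ((d l - b') * (d l - b))" if "l \<notin> Z" for l
  proof -
    have "b < d l" using d[of l] that by (auto simp: Z_def)
    then have "b' - d l \<noteq> 0" "b - d l \<noteq> 0" "d l - b' \<noteq> 0" "d l - b \<noteq> 0" using b by auto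
    then show ?thesis by (simp add: g_def b'_def divide_simps) (simp add: algebra_simps)
  qed
  have g_nonneg: "0 \<le> g l" for l
  proof (cases "l \<in> Z")
    case True
    then show ?thesis using b \<Delta> by (simp add: g_Z)
  next
    case False
    then have "b < d l" using d[of l] by (auto simp: Z_def)
    then show ?thesis using b \<Delta> False by (simp add: g_alt)
  qed
  have "(\<Sum>l\<in>UNIV. 1 / (b - d l)) \<le> (\<Sum>l\<in>UNIV. if l \<in> Z then 1 / b else 0)"
  proof (rule sum_mono)
    fix l show "1 / (b - d l) \<le> (if l \<in> Z then 1 / b else 0)"
      using d[of l] by (auto simp: Z_def divide_simps)
  qed
  also have "\<dots> = p" by (simp add: sum.If_cases p_def)
  finally have "\<Delta> * (\<Sum>l\<in>UNIV. 1 / (b - d l)) \<le> \<Delta> * p" using \<Delta> by (intro mult_left_mono) auto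
  with large have p: "1 \<le> \<Delta> * p" by linarith
  have "\<Delta> * p / b' = (\<Sum>l\<in>UNIV. if l \<in> Z then g l else 0)"
  proof -
    have "(\<Sum>l\<in>UNIV. if l \<in> Z then g l else 0) = (\<Sum>l\<in>Z. g l)" by (simp add: sum.If_cases)
    also have "\<dots> = (\<Sum>l\<in>Z. \<Delta> / (b' * b))" by (intro sum.cong) (auto simp: g_Z)
    finally show ?thesis by (simp add: p_def mult.commute)
  qed
  also have "\<dots> \<le> D" unfolding D using g_nonneg by (intro sum_mono) auto
  finally have D_ge: "\<Delta> * p / b' \<le> D" .
  have "0 < \<Delta> * p / b'" using p b by (intro divide_pos_pos) auto
  with D_ge show D_pos: "0 < D" by linarith
  have bound: "(1 / (b' - d l))\<^sup>2 \<le> g l / \<Delta> + (if l \<in> Z then \<Delta> / (b * b'\<^sup>2) else 0)" for l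
  proof (cases "l \<in> Z")
    case True
    have "(1 / b')\<^sup>2 = 1 / (b' * b) + \<Delta> / (b * b'\<^sup>2)"
      using b by (simp add: b'_def divide_simps power2_eq_square)
    then show ?thesis using True \<Delta> by (simp add: g_Z) (simp add: Z_def)
  next
    case False
    then have "b < d l" using d[of l] by (auto simp: Z_def)
    then have pos: "0 < d l - b" "0 < d l - b'" using b by auto
    have "(1 / (b' - d l))\<^sup>2 = 1 / ((d l - b') * (d l - b'))"
      by (simp add: power2_eq_square algebra_simps)
    also have "\<dots> \<le> 1 / ((d l - b') * (d l - b))"
      using pos b by (intro divide_left_mono mult_left_mono) auto
    finally show ?thesis using False \<Delta> by (simp add: g_alt)
  qed
  have "(\<Sum>l\<in>UNIV. (1 / (b' - d l))\<^sup>2)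
      \<le> (\<Sum>l\<in>UNIV. g l / \<Delta> + (if l \<in> Z then \<Delta> / (b * b'\<^sup>2) else 0))"
    by (intro sum_mono bound)
  also have "\<dots> = D / \<Delta> + \<Delta> * p / b'\<^sup>2"
    by (simp add: sum.distrib D sum_divide_distrib sum.If_cases p_def)
  also have "\<Delta> * p / b'\<^sup>2 \<le> D\<^sup>2"
  proof -
    have "\<Delta> * p / b'\<^sup>2 \<le> (\<Delta> * p) * (\<Delta> * p) / b'\<^sup>2"
      using mult_right_mono[of 1 "\<Delta> * p" "\<Delta> * p"] p by (intro divide_right_mono) auto
    also have "\<dots> = (\<Delta> * p / b')\<^sup>2" by (simp add: power2_eq_square)
    also have "\<dots> \<le> D\<^sup>2" using D_ge \<open>0 < \<Delta> * p / b'\<close> by (intro power_mono) auto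
    finally show ?thesis .
  qed
  finally have "(\<Sum>l\<in>UNIV. (1 / (b' - d l))\<^sup>2) \<le> (D + 1 / \<Delta>) * D"
    by (simp add: algebra_simps power2_eq_square)
  then show "(\<Sum>l\<in>UNIV. (1 / (b - \<Delta> - d l))\<^sup>2) / D \<le> D + 1 / \<Delta>"
    using D_pos by (simp add: pos_divide_le_eq b'_def)
qed

section \<open>Choosing the next vector\<close>

text \<open>The dual form of John's decomposition: a representation of the identity as a combination of
  matrices \<open>x x\<^sup>T\<close> with positive weights would give it by averaging \<open>x \<bullet> M x\<close>.\<close>

definition john_set :: "(real^'n) set \<Rightarrow> bool" where
  "john_set C \<longleftrightarrow> (\<forall>x\<in>C. x \<noteq> 0) \<and>
     (\<forall>M. transpose M = M \<longrightarrow> 0 < trace M \<longrightarrow> (\<exists>x\<in>C. 0 \<le> x \<bullet> (M *v x)))"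

text \<open>When the barriers stay where they are, a vector can be added as soon as one potential exceeds the
  other: the form \<open>x \<bullet> (b - A)\<inverse> x\<close> is then larger than \<open>x \<bullet> (u - A)\<inverse> x\<close> for some \<open>x\<close>, and scaling \<open>x\<close>
  places 1 between the two values.  The potentials may leave their bounds, so this serves for the
  last vector only.\<close>

lemma vector_between_barriers:
  fixes A :: "real^'n^'n"
  assumes C: "john_set C" and Q: "orthogonal_matrix Q" and A: "A = spectral_matrix Q d"
    and up: "\<And>l. d l < u" and low: "\<And>l. d l = 0 \<or> b < d l" and "0 < b"
    and gap: "trace (resolvent u A) < trace (resolvent b A)"
  shows "\<exists>x\<in>C. \<exists>s>0. (s *\<^sub>R x) \<bullet> (resolvent u A *v (s *\<^sub>R x)) < 1 \<and> 1 < (s *\<^sub>R x) \<bullet> (resolvent b A *v (s *\<^sub>R x))"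
proof -
  have ne: "d l \<noteq> u" "d l \<noteq> b" for l using up[of l] low[of l] \<open>0 < b\<close> by auto
  define r where "r c l = 1 / (c - d l)" for c l
  have R: "resolvent u A = spectral_matrix Q (r u)" "resolvent b A = spectral_matrix Q (r b)"
    unfolding A r_def by (auto intro!: resolvent_spectral_matrix Q ne)
  \<comment> \<open>half of the average gap is given away to obtain a strict inequality\<close>
  define \<eta> where "\<eta> = (trace (resolvent b A) - trace (resolvent u A)) / (2 * CARD('n))"
  have \<eta>: "0 < \<eta>" using gap by (simp add: \<eta>_def)
  define M where "M = spectral_matrix Q (\<lambda>l. r b l - r u l - \<eta>)"
  have "trace M = trace (resolvent b A) - trace (resolvent u A) - CARD('n) * \<eta>"
    unfolding M_def R trace_spectral_matrix[OF Q] by (simp add: sum_subtractf)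
  also have "CARD('n) * \<eta> = (trace (resolvent b A) - trace (resolvent u A)) / 2"
    by (simp add: \<eta>_def)
  finally have "trace M = (trace (resolvent b A) - trace (resolvent u A)) / 2" by argo
  then have "0 < trace M" using gap by simp
  then obtain x where x: "x \<in> C" "0 \<le> x \<bullet> (M *v x)" "x \<noteq> 0"
    using C transpose_spectral_matrix unfolding john_set_def M_def by blast
  define z where "z l = (transpose Q *v x) $ l" for l
  define p q where "p = x \<bullet> (resolvent b A *v x)" and "q = x \<bullet> (resolvent u A *v x)"
  have z: "(\<Sum>l\<in>UNIV. (z l)\<^sup>2) = x \<bullet> x"
    unfolding z_def by (rule sum_squares_orthogonal_coordinates[OF Q])
  have "x \<bullet> (M *v x) = p - q - \<eta> * (x \<bullet> x)"
    unfolding p_def q_def M_def R inner_spectral_matrix z_def[symmetric] z[symmetric]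
    by (simp add: left_diff_distrib sum_subtractf sum_distrib_left)
  moreover have "0 < \<eta> * (x \<bullet> x)" using \<eta> x(3) by simp
  ultimately have pq: "q < p" using x(2) by linarith
  have "0 \<le> q"
    unfolding q_def R inner_spectral_matrix
  proof (intro sum_nonneg mult_nonneg_nonneg)
    fix l show "0 \<le> r u l" using up[of l] by (simp add: r_def)
  qed simp
  then have pq0: "0 < p + q" using pq by simp
  define s where "s = sqrt (2 / (p + q))"
  have s: "0 < s" "s\<^sup>2 = 2 / (p + q)" using pq0 by (simp_all add: s_def)
  have "(s *\<^sub>R x) \<bullet> (B *v (s *\<^sub>R x)) = s\<^sup>2 * (x \<bullet> (B *v x))" for B :: "real^'n^'n"
    by (simp add: matrix_vector_mult_scaleR power2_eq_square)
  then have "(s *\<^sub>R x) \<bullet> (resolvent u A *v (s *\<^sub>R x)) = 2 / (p + q) * q"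
    "(s *\<^sub>R x) \<bullet> (resolvent b A *v (s *\<^sub>R x)) = 2 / (p + q) * p"
    by (simp_all add: s p_def q_def)
  moreover have "2 / (p + q) * q < 1" "1 < 2 / (p + q) * p" using pq pq0 by (simp_all add: field_simps)
  ultimately show ?thesis using x(1) s(1) by (intro bexI[of _ x] exI[of _ s]) simp_all
qed

text \<open>By the update formula for the trace, adding \<open>v = s x\<close> does not increase the upper
  potential if \<open>s\<^sup>2 U \<le> 1\<close> and does not decrease the lower one if \<open>s\<^sup>2 L \<ge> 1\<close>, where
  \<open>U = x \<bullet> R x + x \<bullet> R\<^sup>2 x / DU\<close> for \<open>R = (u + \<delta> - A)\<inverse>\<close>,
  \<open>L = x \<bullet> R x - x \<bullet> R\<^sup>2 x / DL\<close> for \<open>R = (b - \<Delta> - A)\<inverse>\<close>, and \<open>DU\<close>, \<open>DL\<close> are the changes of the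
  potentials caused by the moves of the barriers.  The matrix of the form \<open>L - U\<close> has positive
  trace by the two estimates of averages, so some \<open>x\<close> has \<open>U \<le> L\<close>, and \<open>s\<^sup>2 = 1 / U\<close> serves.\<close>

lemma vector_moving_barriers:
  fixes A :: "real^'n^'n"
  assumes C: "john_set C" and Q: "orthogonal_matrix Q" and A: "A = spectral_matrix Q d"
    and up: "\<And>l. d l < u" and low: "\<And>l. d l = 0 \<or> b < d l"
    and \<Delta>: "0 < \<Delta>" "\<Delta> < b" and \<delta>: "0 < \<delta>"
    and large: "1 \<le> \<Delta> * trace (resolvent b A)"
    and gap: "trace (resolvent u A) + 1 / \<delta> \<le> trace (resolvent b A) - 1 / \<Delta>"
  shows "\<exists>x\<in>C. \<exists>s>0. let v = s *\<^sub>R x in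
      v \<bullet> (resolvent (u + \<delta>) A *v v) < 1 \<and> 1 < v \<bullet> (resolvent (b - \<Delta>) A *v v) \<and>
      trace (resolvent (u + \<delta>) (A + outer v)) \<le> trace (resolvent u A) \<and>
      trace (resolvent b A) \<le> trace (resolvent (b - \<Delta>) (A + outer v))"
proof -
  have ne: "d l \<noteq> u" "d l \<noteq> b" "d l \<noteq> u + \<delta>" "d l \<noteq> b - \<Delta>" for l
    using up[of l] low[of l] \<Delta> \<delta> by auto
  define r where "r c l = 1 / (c - d l)" for c l
  define u' b' where "u' = u + \<delta>" and "b' = b - \<Delta>"
  have R: "resolvent u A = spectral_matrix Q (r u)" "resolvent b A = spectral_matrix Q (r b)"
    "resolvent u' A = spectral_matrix Q (r u')" "resolvent b' A = spectral_matrix Q (r b')"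
    unfolding A r_def u'_def b'_def by (auto intro!: resolvent_spectral_matrix Q ne)
  have inv: "(mat u' - A) ** spectral_matrix Q (r u') = mat 1" "(mat b' - A) ** spectral_matrix Q (r b') = mat 1"
    unfolding A r_def u'_def b'_def by (intro spectral_inverse Q ne)+
  have tr: "trace (spectral_matrix Q e) = (\<Sum>l\<in>UNIV. e l)" for e by (rule trace_spectral_matrix[OF Q])
  define DU where "DU = (\<Sum>l\<in>UNIV. r u l) - (\<Sum>l\<in>UNIV. r u' l)"
  define DL where "DL = (\<Sum>l\<in>UNIV. r b' l) - (\<Sum>l\<in>UNIV. r b l)"
  have DU: "0 < DU" "(\<Sum>l\<in>UNIV. (r u' l)\<^sup>2) / DU \<le> 1 / \<delta>"
    using upper_barrier_average[OF up \<delta>] by (simp_all add: DU_def r_def u'_def)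
  have DL: "0 < DL" "(\<Sum>l\<in>UNIV. (r b' l)\<^sup>2) / DL \<le> DL + 1 / \<Delta>"
    using lower_barrier_average[OF low \<Delta>] large[unfolded R tr] by (simp_all add: DL_def r_def b'_def)
  define M where "M = spectral_matrix Q (\<lambda>l. (r b' l - (r b' l)\<^sup>2 / DL) - (r u' l + (r u' l)\<^sup>2 / DU))"
  have "trace M = ((\<Sum>l\<in>UNIV. r b' l) - (\<Sum>l\<in>UNIV. (r b' l)\<^sup>2) / DL)
      - ((\<Sum>l\<in>UNIV. r u' l) + (\<Sum>l\<in>UNIV. (r u' l)\<^sup>2) / DU)"
    unfolding M_def tr by (simp add: sum_subtractf sum.distrib sum_divide_distrib)
  moreover have "(\<Sum>l\<in>UNIV. r u l) + 1 / \<delta> \<le> (\<Sum>l\<in>UNIV. r b l) - 1 / \<Delta>"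
    using gap unfolding R tr .
  ultimately have "0 < trace M" using DU DL by (simp add: DU_def DL_def)
  then obtain x where x: "x \<in> C" "0 \<le> x \<bullet> (M *v x)" "x \<noteq> 0"
    using C transpose_spectral_matrix unfolding john_set_def M_def by blast
  define z where "z l = (transpose Q *v x) $ l" for l
  define S where "S e = (\<Sum>l\<in>UNIV. e l * (z l)\<^sup>2)" for e
  have quad: "x \<bullet> (spectral_matrix Q e *v x) = S e" for e
    unfolding S_def z_def by (rule inner_spectral_matrix)
  define L U where "L = S (r b') - S (\<lambda>l. (r b' l)\<^sup>2) / DL" and "U = S (r u') + S (\<lambda>l. (r u' l)\<^sup>2) / DU"
  have "x \<bullet> (M *v x) = L - U"
    unfolding M_def quad L_def U_def S_def
    by (simp add: sum_subtractf sum.distrib sum_divide_distrib algebra_simps diff_divide_distrib add_divide_distrib)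
  then have "U \<le> L" using x(2) by simp
  have Sz: "(\<Sum>l\<in>UNIV. (z l)\<^sup>2) = x \<bullet> x"
    unfolding z_def by (rule sum_squares_orthogonal_coordinates[OF Q])
  have S_pos: "0 < S (\<lambda>l. (r c l)\<^sup>2)" if "\<And>l. d l \<noteq> c" for c
  proof -
    have "\<exists>l. z l \<noteq> 0"
    proof (rule ccontr)
      assume "\<not> ?thesis"
      then have "x \<bullet> x = 0" using Sz by simp
      then show False using x(3) by simp
    qed
    then obtain l where "z l \<noteq> 0" by blast
    then have "0 < (r c l)\<^sup>2 * (z l)\<^sup>2" using that[of l] by (simp add: r_def)
    then show ?thesis unfolding S_def by (intro sum_pos2[of _ l]) auto
  qed
  have Su_nonneg: "0 \<le> S (r u')"
    unfolding S_def
  proof (intro sum_nonneg mult_nonneg_nonneg)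
    fix l show "0 \<le> r u' l" using up[of l] \<delta> by (simp add: r_def u'_def)
  qed simp
  have Su2: "0 < S (\<lambda>l. (r u' l)\<^sup>2)" and Sb2: "0 < S (\<lambda>l. (r b' l)\<^sup>2)"
    using S_pos[of u'] S_pos[of b'] ne by (simp_all add: u'_def b'_def)
  have U_pos: "0 < U" unfolding U_def using Su_nonneg Su2 DU(1) by (intro add_nonneg_pos) auto
  define s where "s = sqrt (1 / U)"
  have s: "0 < s" "s\<^sup>2 = 1 / U" using U_pos by (simp_all add: s_def)
  define v where "v = s *\<^sub>R x"
  have vq: "v \<bullet> (spectral_matrix Q e *v v) = S e / U" for e
    unfolding v_def by (simp add: matrix_vector_mult_scaleR quad s flip: power2_eq_square mult.assoc)
  have vn: "(spectral_matrix Q e *v v) \<bullet> (spectral_matrix Q e *v v) = S (\<lambda>l. (e l)\<^sup>2) / U" for e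
  proof -
    have "(spectral_matrix Q e *v v) \<bullet> (spectral_matrix Q e *v v)
        = v \<bullet> (spectral_matrix Q e *v (spectral_matrix Q e *v v))"
      using symmetric_inner_commute[OF transpose_spectral_matrix, of _ Q e v] by (simp add: inner_commute)
    also have "\<dots> = S (\<lambda>l. (e l)\<^sup>2) / U"
      by (simp add: matrix_vector_mul_assoc spectral_matrix_mult[OF Q] vq power2_eq_square)
    finally show ?thesis .
  qed
  have u_lt: "S (r u') / U < 1"
    using U_pos Su2 DU(1) by (simp add: U_def)
  have b_gt: "1 < S (r b') / U"
  proof -
    have "0 < S (\<lambda>l. (r b' l)\<^sup>2) / DL" using Sb2 DL(1) by simp
    then show ?thesis using \<open>U \<le> L\<close> U_pos by (simp add: L_def)
  qed
  have "trace (resolvent u' (A + outer v)) = (\<Sum>l\<in>UNIV. r u' l) + (S (\<lambda>l. (r u' l)\<^sup>2) / U) / (1 - S (r u') / U)"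
    using trace_resolvent_rank_one_update[OF inv(1) transpose_spectral_matrix, of v] u_lt
    unfolding vq vn tr by linarith
  also have "(S (\<lambda>l. (r u' l)\<^sup>2) / U) / (1 - S (r u') / U) = DU"
  proof -
    have "1 - S (r u') / U = (S (\<lambda>l. (r u' l)\<^sup>2) / DU) / U"
      using U_pos by (simp add: U_def diff_divide_eq_iff field_simps)
    then show ?thesis using U_pos Su2 DU(1) by simp
  qed
  finally have up': "trace (resolvent u' (A + outer v)) = trace (resolvent u A)"
    by (simp add: R tr DU_def)
  have "trace (resolvent b' (A + outer v)) = (\<Sum>l\<in>UNIV. r b' l) + (S (\<lambda>l. (r b' l)\<^sup>2) / U) / (1 - S (r b') / U)"
    using trace_resolvent_rank_one_update[OF inv(2) transpose_spectral_matrix, of v] b_gt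
    unfolding vq vn tr by linarith
  moreover have "- DL \<le> (S (\<lambda>l. (r b' l)\<^sup>2) / U) / (1 - S (r b') / U)"
  proof -
    have "(S (\<lambda>l. (r b' l)\<^sup>2) / U) / (1 - S (r b') / U) = - (S (\<lambda>l. (r b' l)\<^sup>2) / (S (r b') - U))"
      using U_pos b_gt by (simp add: divide_simps) (simp add: algebra_simps)
    moreover have "S (\<lambda>l. (r b' l)\<^sup>2) / (S (r b') - U) \<le> DL"
    proof -
      have *: "S (\<lambda>l. (r b' l)\<^sup>2) / DL \<le> S (r b') - U" using \<open>U \<le> L\<close> by (simp add: L_def)
      have "0 < S (\<lambda>l. (r b' l)\<^sup>2) / DL" using Sb2 DL(1) by simp
      then have "0 < S (r b') - U" using * by linarith
      then show ?thesis using * DL(1) by (simp add: field_simps)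
    qed
    ultimately show ?thesis by simp
  qed
  ultimately have low': "trace (resolvent b A) \<le> trace (resolvent b' (A + outer v))"
    by (simp add: R tr DL_def)
  have "v \<bullet> (resolvent u' A *v v) < 1" "1 < v \<bullet> (resolvent b' A *v v)"
    unfolding R vq by (rule u_lt, rule b_gt)
  with up' low' x(1) s(1) show ?thesis
    unfolding u'_def b'_def v_def by (intro bexI[of _ x] exI[of _ s]) (auto simp: Let_def)
qed

section \<open>The selection process\<close>

lemma trace_resolvent_zero: "c \<noteq> 0 \<Longrightarrow> trace (resolvent c (0 :: real^'n^'n)) = CARD('n) / c"
proof -
  assume "c \<noteq> 0"
  then have "resolvent c (0 :: real^'n^'n) = mat (1 / c)"
    by (intro resolvent_eqI)
       (simp add: vec_eq_iff matrix_matrix_mult_def mat_def if_distrib[of "\<lambda>t. t * _"] if_distrib[of "\<lambda>t. _ * t"] cong: if_cong)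
  then show ?thesis by (simp add: trace_def mat_def)
qed

text \<open>With \<open>q = 1 - \<epsilon>\<close> the barriers start at \<open>b = 1\<close> and \<open>u = (1 + q) / \<epsilon>\<close>, where the potentials of the
  zero matrix are \<open>n\<close> and \<open>n \<epsilon> / (1 + q)\<close>.  The steps \<open>\<Delta> = 1 / (q n)\<close> and
  \<open>\<delta> = (1 + q) / (\<epsilon> q n)\<close> satisfy \<open>n \<epsilon> / (1 + q) + 1 / \<delta> = n \<epsilon> = n - 1 / \<Delta>\<close>, which is what a step
  requires.  Among the choices with constant steps this one minimises the ratio of the barriers after
  \<open>q\<^sup>2 n\<close> steps, namely \<open>((1 + q) / (1 - q))\<^sup>2\<close>.\<close>

lemma two_barrier_process:
  fixes C :: "(real^'n) set" and \<epsilon> :: real and m :: nat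
  assumes C: "john_set C" and \<epsilon>: "0 < \<epsilon>" "\<epsilon> < 1"
    and m: "real m < (1 - \<epsilon>)\<^sup>2 * CARD('n)"
  defines "b \<equiv> \<lambda>i. 1 - real i / ((1 - \<epsilon>) * CARD('n))"
    and "u \<equiv> \<lambda>i. (2 - \<epsilon>) / \<epsilon> * (1 + real i / ((1 - \<epsilon>) * CARD('n)))"
  shows "i \<le> m \<Longrightarrow> \<exists>y. (\<forall>j\<in>{1..i}. \<exists>x\<in>C. \<exists>s>0. y j = s *\<^sub>R x) \<and>
      gram_between y i (b i) (u i) \<and>
      trace (resolvent (u i) (frame y i)) \<le> CARD('n) * \<epsilon> / (2 - \<epsilon>) \<and>
      CARD('n) \<le> trace (resolvent (b i) (frame y i))"
proof (induction i)
  case 0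
  have "0 < (2 - \<epsilon>) / \<epsilon>" using \<epsilon> by simp
  then show ?case
    using \<epsilon> by (intro exI[of _ "\<lambda>_. 0"]) (simp add: gram_between_0 frame_0 trace_resolvent_zero b_def u_def)
next
  case (Suc i)
  define n where "n = real CARD('n)"
  define q where "q = 1 - \<epsilon>"
  define \<Delta> where "\<Delta> = 1 / (q * n)"
  define \<delta> where "\<delta> = (2 - \<epsilon>) / (\<epsilon> * (q * n))"
  have n: "0 < n" and q: "0 < q" "q < 1" using \<epsilon> by (auto simp: n_def q_def)
  have pos: "0 < \<Delta>" "0 < \<delta>" using n q \<epsilon> by (simp_all add: \<Delta>_def \<delta>_def)
  have b_Suc: "b (Suc i) = b i - \<Delta>"
    by (simp add: b_def \<Delta>_def n_def q_def add_divide_distrib)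
  have u_Suc: "u (Suc i) = u i + \<delta>"
    by (simp add: u_def \<delta>_def n_def q_def add_divide_distrib distrib_left)
  have "real (Suc i) < q * (q * n)" using m Suc.prems by (simp add: n_def q_def power2_eq_square mult.assoc)
  then have "real (Suc i) / (q * n) < q" using n q by (simp add: divide_less_eq)
  moreover have "b (Suc i) = 1 - real (Suc i) / (q * n)" by (simp only: b_def n_def q_def)
  ultimately have b_pos: "0 < b (Suc i)" using q by linarith
  from Suc obtain y where y: "\<forall>j\<in>{1..i}. \<exists>x\<in>C. \<exists>s>0. y j = s *\<^sub>R x"
    and gb: "gram_between y i (b i) (u i)"
    and up: "trace (resolvent (u i) (frame y i)) \<le> n * \<epsilon> / (2 - \<epsilon>)"
    and low: "n \<le> trace (resolvent (b i) (frame y i))"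
    unfolding n_def by auto
  obtain Q d where Q: "orthogonal_matrix Q" and A: "frame y i = spectral_matrix Q d"
    using spectral_theorem[OF transpose_frame] by blast
  note spec = gram_between_spectrum[OF gb Q A]
  have large: "1 \<le> \<Delta> * trace (resolvent (b i) (frame y i))"
  proof -
    have "1 \<le> \<Delta> * n" using n q by (simp add: \<Delta>_def)
    also have "\<dots> \<le> \<Delta> * trace (resolvent (b i) (frame y i))" using low pos by simp
    finally show ?thesis .
  qed
  have "n * \<epsilon> / (2 - \<epsilon>) + 1 / \<delta> = n - 1 / \<Delta>"
    using n q \<epsilon> by (simp add: \<delta>_def \<Delta>_def q_def divide_simps) (simp add: algebra_simps)
  then have gap: "trace (resolvent (u i) (frame y i)) + 1 / \<delta> \<le> trace (resolvent (b i) (frame y i)) - 1 / \<Delta>"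
    using up low by linarith
  obtain x s where x: "x \<in> C" and s: "0 < s"
    and v: "(s *\<^sub>R x) \<bullet> (resolvent (u i + \<delta>) (frame y i) *v (s *\<^sub>R x)) < 1"
      "1 < (s *\<^sub>R x) \<bullet> (resolvent (b i - \<Delta>) (frame y i) *v (s *\<^sub>R x))"
      "trace (resolvent (u i + \<delta>) (frame y i + outer (s *\<^sub>R x))) \<le> trace (resolvent (u i) (frame y i))"
      "trace (resolvent (b i) (frame y i)) \<le> trace (resolvent (b i - \<Delta>) (frame y i + outer (s *\<^sub>R x)))"
    using vector_moving_barriers[OF C Q A spec(2,3) pos(1) _ pos(2) large gap] b_pos b_Suc
    unfolding Let_def by auto
  have ne: "d l \<noteq> u i + \<delta>" "d l \<noteq> b i - \<Delta>" for l
    using spec[of l] pos b_pos b_Suc by auto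
  have inv: "(mat (u i + \<delta>) - frame y i) ** resolvent (u i + \<delta>) (frame y i) = mat 1"
    "(mat (b i - \<Delta>) - frame y i) ** resolvent (b i - \<Delta>) (frame y i) = mat 1"
    unfolding A by (simp_all add: resolvent_spectral_matrix[OF Q] spectral_inverse[OF Q] ne)
  have "gram_between y i (b i - \<Delta>) (u i + \<delta>)"
    using pos by (intro gram_between_mono[OF gb]) auto
  then have "gram_between (y(Suc i := s *\<^sub>R x)) (Suc i) (b i - \<Delta>) (u i + \<delta>)"
    using b_pos b_Suc by (intro gram_between_extend[OF _ _ inv(2) v(2) inv(1) v(1)]) auto
  moreover have "\<exists>x'\<in>C. \<exists>s'>0. (y(Suc i := s *\<^sub>R x)) j = s' *\<^sub>R x'" if "j \<in> {1..Suc i}" for j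
    using y x s that by (cases "j = Suc i") auto
  moreover have "trace (resolvent (u i + \<delta>) (frame y i + outer (s *\<^sub>R x))) \<le> n * \<epsilon> / (2 - \<epsilon>)"
    "n \<le> trace (resolvent (b i - \<Delta>) (frame y i + outer (s *\<^sub>R x)))"
    using v(3,4) up low by linarith+
  ultimately show ?case
    unfolding b_Suc u_Suc n_def frame_Suc[symmetric]
    by (intro exI[of _ "y(Suc i := s *\<^sub>R x)"] conjI ballI)
qed

text \<open>After \<open>m\<close> steps with moving barriers, \<open>m\<close> being the largest integer below \<open>(1 - \<epsilon>)\<^sup>2 n\<close>, one more
  vector is added between the barriers reached.\<close>

lemma weighted_selection:
  fixes C :: "(real^'n) set" and \<epsilon> :: real
  assumes C: "john_set C" and \<epsilon>: "0 < \<epsilon>" "\<epsilon> < 1"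
  shows "\<exists>k y. (\<forall>j\<in>{1..k}. \<exists>x\<in>C. \<exists>s>0. y j = s *\<^sub>R x) \<and>
      (1 - \<epsilon>)\<^sup>2 * CARD('n) \<le> real k \<and> gram_between y k \<epsilon> ((2 - \<epsilon>)\<^sup>2 / \<epsilon>)"
proof -
  define n where "n = real CARD('n)"
  define q where "q = 1 - \<epsilon>"
  have n: "0 < n" and q: "0 < q" "q < 1" using \<epsilon> by (auto simp: n_def q_def)
  define m where "m = nat \<lceil>q\<^sup>2 * n\<rceil> - 1"
  have "0 < q\<^sup>2 * n" using n q by simp
  then have m: "real m < q\<^sup>2 * n" "q\<^sup>2 * n \<le> real (Suc m)" unfolding m_def by linarith+
  define b where "b = 1 - real m / (q * n)"
  define u where "u = (2 - \<epsilon>) / \<epsilon> * (1 + real m / (q * n))"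
  have "real m / (q * n) < q" using m(1) n q by (simp add: divide_less_eq power2_eq_square mult.assoc)
  then have b: "\<epsilon> \<le> b" and "1 + real m / (q * n) \<le> 2 - \<epsilon>" by (auto simp: b_def q_def)
  then have "u \<le> (2 - \<epsilon>) / \<epsilon> * (2 - \<epsilon>)"
    unfolding u_def using \<epsilon> by (intro mult_left_mono) auto
  then have u: "u \<le> (2 - \<epsilon>)\<^sup>2 / \<epsilon>" by (simp add: power2_eq_square)
  obtain y where y: "\<forall>j\<in>{1..m}. \<exists>x\<in>C. \<exists>s>0. y j = s *\<^sub>R x"
    and gb: "gram_between y m b u"
    and up: "trace (resolvent u (frame y m)) \<le> n * \<epsilon> / (2 - \<epsilon>)"
    and low: "n \<le> trace (resolvent b (frame y m))"
    using two_barrier_process[OF C \<epsilon>, of m m] m(1) unfolding n_def q_def b_def u_def by auto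
  obtain Q d where Q: "orthogonal_matrix Q" and A: "frame y m = spectral_matrix Q d"
    using spectral_theorem[OF transpose_frame] by blast
  note spec = gram_between_spectrum[OF gb Q A]
  have b_pos: "0 < b" using b \<epsilon> by simp
  have "n * \<epsilon> / (2 - \<epsilon>) < n" using n \<epsilon> by (simp add: divide_less_eq)
  then have "trace (resolvent u (frame y m)) < trace (resolvent b (frame y m))" using up low by linarith
  then obtain x s where x: "x \<in> C" and s: "0 < s"
    and v: "(s *\<^sub>R x) \<bullet> (resolvent u (frame y m) *v (s *\<^sub>R x)) < 1"
      "1 < (s *\<^sub>R x) \<bullet> (resolvent b (frame y m) *v (s *\<^sub>R x))"
    using vector_between_barriers[OF C Q A spec(2,3) b_pos] by blast
  have ne: "d l \<noteq> u" "d l \<noteq> b" for l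
    using spec[of l] b_pos by auto
  have inv: "(mat u - frame y m) ** resolvent u (frame y m) = mat 1"
    "(mat b - frame y m) ** resolvent b (frame y m) = mat 1"
    unfolding A by (simp_all add: resolvent_spectral_matrix[OF Q] spectral_inverse[OF Q] ne)
  have "gram_between (y(Suc m := s *\<^sub>R x)) (Suc m) b u"
    by (rule gram_between_extend[OF gb b_pos inv(2) v(2) inv(1) v(1)])
  then have "gram_between (y(Suc m := s *\<^sub>R x)) (Suc m) \<epsilon> ((2 - \<epsilon>)\<^sup>2 / \<epsilon>)"
    using b u by (rule gram_between_mono)
  moreover have "\<exists>x'\<in>C. \<exists>s'>0. (y(Suc m := s *\<^sub>R x)) j = s' *\<^sub>R x'" if "j \<in> {1..Suc m}" for j
    using y x s that by (cases "j = Suc m") auto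
  ultimately show ?thesis
    using m(2) unfolding n_def q_def by blast
qed

section \<open>From weighted vectors to unit vectors\<close>

text \<open>The Gram matrix \<open>Y\<^sup>T Y\<close> inherits the upper bound of \<open>Y Y\<^sup>T\<close>: for \<open>z = Y a\<close> the inequality of
  Cauchy and Schwarz bounds \<open>(z \<bullet> z)\<^sup>2 = (a \<bullet> Y\<^sup>T z)\<^sup>2\<close> by \<open>\<parallel>a\<parallel>\<^sup>2 (z \<bullet> Y Y\<^sup>T z)\<close>.\<close>

lemma gram_between_upper:
  fixes y :: "nat \<Rightarrow> real^'n"
  assumes gb: "gram_between y k b u" and u: "0 \<le> u"
  shows "(norm (\<Sum>j=1..k. a j *\<^sub>R y j))\<^sup>2 \<le> u * (\<Sum>j=1..k. (a j)\<^sup>2)"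
proof (cases "(\<Sum>j=1..k. a j *\<^sub>R y j) = 0")
  case True
  have "0 \<le> u * (\<Sum>j=1..k. (a j)\<^sup>2)" using u by (intro mult_nonneg_nonneg sum_nonneg) auto
  with True show ?thesis by simp
next
  case False
  define z where "z = (\<Sum>j=1..k. a j *\<^sub>R y j)"
  have z: "0 < z \<bullet> z" using False by (simp add: z_def)
  have "z \<bullet> z = (\<Sum>j=1..k. a j * (y j \<bullet> z))"
    by (subst (1) z_def) (simp add: inner_sum_left)
  then have "(z \<bullet> z)\<^sup>2 \<le> (\<Sum>j=1..k. (a j)\<^sup>2) * (\<Sum>j=1..k. (y j \<bullet> z)\<^sup>2)"
    using Cauchy_Schwarz_ineq_sum[of a "\<lambda>j. y j \<bullet> z" "{1..k}"] by simp
  also have "(\<Sum>j=1..k. (y j \<bullet> z)\<^sup>2) = z \<bullet> (frame y k *v z)"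
    by (simp add: inner_frame power2_eq_square)
  also have "(\<Sum>j=1..k. (a j)\<^sup>2) * (z \<bullet> (frame y k *v z)) \<le> (\<Sum>j=1..k. (a j)\<^sup>2) * (u * (z \<bullet> z))"
    using gb z unfolding gram_between_def by (intro mult_left_mono sum_nonneg) (auto simp: less_imp_le)
  finally have "(z \<bullet> z) * (z \<bullet> z) \<le> (u * (\<Sum>j=1..k. (a j)\<^sup>2)) * (z \<bullet> z)"
    by (simp add: power2_eq_square mult_ac)
  then have "z \<bullet> z \<le> u * (\<Sum>j=1..k. (a j)\<^sup>2)" using z by simp
  then show ?thesis by (simp add: z_def power2_norm_eq_inner)
qed

lemma gram_between_lower:
  fixes y :: "nat \<Rightarrow> real^'n"
  assumes gb: "gram_between y k b u"
  shows "b * (\<Sum>j=1..k. (a j)\<^sup>2) \<le> (norm (\<Sum>j=1..k. a j *\<^sub>R y j))\<^sup>2"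
proof (cases "\<exists>j\<in>{1..k}. a j \<noteq> 0")
  case True
  then show ?thesis using gb unfolding gram_between_def by (simp add: less_imp_le)
qed simp

text \<open>The squared weights \<open>(s j)\<^sup>2\<close> are the diagonal entries of the Gram matrix of the \<open>y j\<close>, and diagonal
  entries lie between the extreme eigenvalues.  Hence passing from \<open>a j\<close> to the coefficients
  \<open>a j / s j\<close> of the \<open>y j\<close> changes the square sum by a factor between \<open>1 / u\<close> and \<open>1 / b\<close>.\<close>

lemma norm_bounds_if_gram_between:
  fixes y x :: "nat \<Rightarrow> real^'n"
  assumes gb: "gram_between y k b u" and bu: "0 < b" "0 < u"
    and x: "\<And>j. j \<in> {1..k} \<Longrightarrow> norm (x j) = 1"
    and y: "\<And>j. j \<in> {1..k} \<Longrightarrow> 0 < s j \<and> y j = s j *\<^sub>R x j"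
  shows "b / u * (\<Sum>j=1..k. (a j)\<^sup>2) \<le> (norm (\<Sum>j=1..k. a j *\<^sub>R x j))\<^sup>2"
    and "(norm (\<Sum>j=1..k. a j *\<^sub>R x j))\<^sup>2 \<le> u / b * (\<Sum>j=1..k. (a j)\<^sup>2)"
proof -
  have s: "b \<le> (s j)\<^sup>2" "(s j)\<^sup>2 \<le> u" if j: "j \<in> {1..k}" for j
  proof -
    let ?e = "\<lambda>i. if i = j then 1 else 0 :: real"
    have "(\<Sum>i=1..k. ?e i *\<^sub>R y i) = (\<Sum>i=1..k. if i = j then y i else 0)"
      by (intro sum.cong) auto
    also have "\<dots> = y j" using j by simp
    finally have "(norm (\<Sum>i=1..k. ?e i *\<^sub>R y i))\<^sup>2 = (s j)\<^sup>2"
      using y[OF j] x[OF j] by simp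
    moreover have "(\<Sum>i=1..k. (?e i)\<^sup>2) = 1"
    proof -
      have "(\<Sum>i=1..k. (?e i)\<^sup>2) = (\<Sum>i=1..k. ?e i)" by (intro sum.cong) auto
      then show ?thesis using j by simp
    qed
    ultimately show "b \<le> (s j)\<^sup>2" "(s j)\<^sup>2 \<le> u"
      using gram_between_lower[OF gb, of ?e] gram_between_upper[OF gb, of ?e] bu by simp_all
  qed
  define c where "c j = a j / s j" for j
  have c: "(\<Sum>j=1..k. c j *\<^sub>R y j) = (\<Sum>j=1..k. a j *\<^sub>R x j)"
  proof (intro sum.cong refl)
    fix j assume "j \<in> {1..k}"
    with y show "c j *\<^sub>R y j = a j *\<^sub>R x j" by (force simp: c_def)
  qed
  have c_sq: "(a j)\<^sup>2 / u \<le> (c j)\<^sup>2" "(c j)\<^sup>2 \<le> (a j)\<^sup>2 / b" if j: "j \<in> {1..k}" for j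
    unfolding c_def power_divide using s[OF j] y[OF j] bu by (auto intro!: divide_left_mono)
  have "b / u * (\<Sum>j=1..k. (a j)\<^sup>2) = b * (\<Sum>j=1..k. (a j)\<^sup>2 / u)"
    by (simp flip: sum_divide_distrib)
  also have "\<dots> \<le> b * (\<Sum>j=1..k. (c j)\<^sup>2)"
    using bu c_sq(1) by (intro mult_left_mono sum_mono) auto
  also have "\<dots> \<le> (norm (\<Sum>j=1..k. a j *\<^sub>R x j))\<^sup>2"
    using gram_between_lower[OF gb, of c] unfolding c .
  finally show "b / u * (\<Sum>j=1..k. (a j)\<^sup>2) \<le> (norm (\<Sum>j=1..k. a j *\<^sub>R x j))\<^sup>2" .
  have "(norm (\<Sum>j=1..k. a j *\<^sub>R x j))\<^sup>2 \<le> u * (\<Sum>j=1..k. (c j)\<^sup>2)"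
    using gram_between_upper[OF gb less_imp_le[OF bu(2)], of c] unfolding c .
  also have "\<dots> \<le> u * (\<Sum>j=1..k. (a j)\<^sup>2 / b)"
    using bu c_sq(2) by (intro mult_left_mono sum_mono) auto
  also have "\<dots> = u / b * (\<Sum>j=1..k. (a j)\<^sup>2)"
    by (simp flip: sum_divide_distrib)
  finally show "(norm (\<Sum>j=1..k. a j *\<^sub>R x j))\<^sup>2 \<le> u / b * (\<Sum>j=1..k. (a j)\<^sup>2)" .
qed

theorem proposition3p2:
  fixes N :: "real ^ 'n \<Rightarrow> real" and \<epsilon> :: real
  assumes "is_norm N"
    and "max_volume_ellipsoid (cball 0 1) (unit_ball N)"
    and "0 < \<epsilon>" and "\<epsilon> < 1"
  shows "\<exists>(k::nat) (x :: nat \<Rightarrow> real ^ 'n).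
    (\<forall>j\<in>{1..k}. contact_point N (x j)) \<and>
    real k \<ge> (1 - \<epsilon>)\<^sup>2 * real CARD('n) \<and>
    (\<forall>a :: nat \<Rightarrow> real.
       \<epsilon> / (2 - \<epsilon>) * sqrt (\<Sum>j=1..k. (a j)\<^sup>2) \<le> norm (\<Sum>j=1..k. a j *\<^sub>R x j) \<and>
       norm (\<Sum>j=1..k. a j *\<^sub>R x j) \<le> (2 - \<epsilon>) / \<epsilon> * sqrt (\<Sum>j=1..k. (a j)\<^sup>2))"
proof -
  have "john_set {x. contact_point N x}"
    unfolding john_set_def
    using contact_point_with_nonneg_form[OF assms(1,2)] by (auto simp: contact_point_def)
  from weighted_selection[OF this assms(3,4)] obtain k y
    where y: "\<forall>j\<in>{1..k}. \<exists>x. contact_point N x \<and> (\<exists>s>0. y j = s *\<^sub>R x)"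
      and k: "(1 - \<epsilon>)\<^sup>2 * real CARD('n) \<le> real k"
      and gb: "gram_between y k \<epsilon> ((2 - \<epsilon>)\<^sup>2 / \<epsilon>)"
    by auto
  from bchoice[OF y] obtain x
    where xs: "\<forall>j\<in>{1..k}. contact_point N (x j) \<and> (\<exists>s>0. y j = s *\<^sub>R x j)" ..
  then have x: "contact_point N (x j)" if "j \<in> {1..k}" for j using that by blast
  from xs have "\<forall>j\<in>{1..k}. \<exists>s. 0 < s \<and> y j = s *\<^sub>R x j" by blast
  from bchoice[OF this] obtain s where s: "\<forall>j\<in>{1..k}. 0 < s j \<and> y j = s j *\<^sub>R x j" ..
  have u: "0 < (2 - \<epsilon>)\<^sup>2 / \<epsilon>" using assms(3,4) by simp
  have r: "0 < (2 - \<epsilon>) / \<epsilon>" "\<epsilon> / ((2 - \<epsilon>)\<^sup>2 / \<epsilon>) = (\<epsilon> / (2 - \<epsilon>))\<^sup>2"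
    "(2 - \<epsilon>)\<^sup>2 / \<epsilon> / \<epsilon> = ((2 - \<epsilon>) / \<epsilon>)\<^sup>2"
    using assms(3,4) by (simp_all add: power2_eq_square)
  have "\<epsilon> / (2 - \<epsilon>) * sqrt (\<Sum>j=1..k. (a j)\<^sup>2) \<le> norm (\<Sum>j=1..k. a j *\<^sub>R x j) \<and>
       norm (\<Sum>j=1..k. a j *\<^sub>R x j) \<le> (2 - \<epsilon>) / \<epsilon> * sqrt (\<Sum>j=1..k. (a j)\<^sup>2)" for a
  proof -
    define S where "S = (\<Sum>j=1..k. (a j)\<^sup>2)"
    have S: "0 \<le> S" by (simp add: S_def sum_nonneg)
    have unit: "\<And>j. j \<in> {1..k} \<Longrightarrow> norm (x j) = 1" using x by (simp add: contact_point_def)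
    note bounds = norm_bounds_if_gram_between[OF gb assms(3) u unit s[rule_format], of a, unfolded r(2,3) S_def[symmetric]]
    have "\<epsilon> / (2 - \<epsilon>) * sqrt S \<le> norm (\<Sum>j=1..k. a j *\<^sub>R x j)"
    proof (rule power2_le_imp_le)
      show "(\<epsilon> / (2 - \<epsilon>) * sqrt S)\<^sup>2 \<le> (norm (\<Sum>j=1..k. a j *\<^sub>R x j))\<^sup>2"
        unfolding power_mult_distrib real_sqrt_pow2[OF S] by (rule bounds(1))
    qed (rule norm_ge_zero)
    moreover have "norm (\<Sum>j=1..k. a j *\<^sub>R x j) \<le> (2 - \<epsilon>) / \<epsilon> * sqrt S"
    proof (rule power2_le_imp_le)
      show "(norm (\<Sum>j=1..k. a j *\<^sub>R x j))\<^sup>2 \<le> ((2 - \<epsilon>) / \<epsilon> * sqrt S)\<^sup>2"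
        unfolding power_mult_distrib real_sqrt_pow2[OF S] by (rule bounds(2))
    qed (intro mult_nonneg_nonneg real_sqrt_ge_zero S less_imp_le[OF r(1)])
    ultimately show ?thesis by (simp add: S_def)
  qed
  then show ?thesis using x k by blast
qed

end
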